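(* Let $m,n\ge 1$ be integers and suppose $A\in\mathcal{M}_n(\mathbb{C})$ satisfies $w(A)=\|A\|$. Let the eigenvalues of $A$ be listed (with algebraic multiplicity) as $a_1,\dots,a_n$ such that $|a_1|=\cdots=|a_k|>|a_{k+1}|,\dots,|a_n|$ for some $k\ge 1$. (1) The Jordan blocks of $A$ corresponding to the maximum-modulus eigenvalues $a_1,\dots,a_k$ are of size $1\times 1$. (2) Let $U=[u_1|\cdots|u_k|B]$ be any unitary matrix (with first $k$ columns $u_1,\dots,u_k$) such that $U^*AU=\mathrm{diag}(a_1,\dots,a_k)\oplus A'$ for some $A'\in\mathcal{M}_{n-k}(\mathbb{C})$. Then $w(A^{\circ m})=w(A)^m$ if and only if the subspace $$\mathrm{span}_{\mathbb{C}}\{u_{j_1}\otimes\cdots\otimes u_{j_m} : 1\le j_1,\dots,j_m\le k\}\ \cap\ \mathrm{span}_{\mathbb{C}}\{\mathbf{e}_j^{\otimes m} : j=1,\dots,n\}$$ is nonzero and contains an eigenvector of $A^{\otimes m}$; equivalently, if and only if $\mathrm{span}_{\mathbb{C}}\{\mathbf{e}_j^{\otimes m} : j=1,\dots,n\}$ contains an eigenvector of $A^{\otimes m}$ with eigenvalue $\lambda$ such that $|\lambda|=|a_1|^m=\|A\|^m$. Moreover, if $w(A^{\circ m})=w(A)^m$, then $w(A^{\circ m'})=w(A)^{m'}$ for every integer $1\le m'\le m$.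
   Context: For a complex square matrix $A$, $\|A\|$ is the spectral norm (operator norm with respect to the Euclidean norm) and $w(A)=\sup\{|\langle Ax,x\rangle| : \|x\|=1\}$ is the numerical radius. $A^{\circ m}=[a_{ij}^m]$ is the entrywise (Schur/Hadamard) $m$-th power of a matrix $A=[a_{ij}]$, and $A^{\otimes m}$ is the $m$-fold Kronecker product of $A$ with itself, acting on $(\mathbb{C}^n)^{\otimes m}\cong\mathbb{C}^{n^m}$. $\mathbf{e}_1,\dots,\mathbf{e}_n$ is the standard basis of $\mathbb{C}^n$. $X\oplus Y$ denotes the block diagonal matrix with blocks $X,Y$ (the block $A'$ being absent when $k=n$). *)

theory Defs
  imports
    "Jordan_Normal_Form.Matrix"
    "Jordan_Normal_Form.Char_Poly"
    "Jordan_Normal_Form.Jordan_Normal_Form"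
    "Jordan_Normal_Form.Jordan_Normal_Form_Existence"
    "Jordan_Normal_Form.Schur_Decomposition"
    "Jordan_Normal_Form.VS_Connect"
begin

definition euclid_norm :: "complex vec \<Rightarrow> real" where
  "euclid_norm x = sqrt (\<Sum>i<dim_vec x. (cmod (x $ i))\<^sup>2)"

text \<open>The suprema below are taken over nonempty, bounded sets of reals only if the dimension is
  positive; for dimension 0 their values are arbitrary.\<close>

definition spectral_norm :: "complex mat \<Rightarrow> real" where
  "spectral_norm A =
     Sup {euclid_norm (A *\<^sub>v x) | x. x \<in> carrier_vec (dim_col A) \<and> euclid_norm x = 1}"

definition numerical_radius :: "complex mat \<Rightarrow> real" where
  "numerical_radius A =
     Sup {cmod ((A *\<^sub>v x) \<bullet>c x) | x. x \<in> carrier_vec (dim_col A) \<and> euclid_norm x = 1}"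

definition schur_power :: "complex mat \<Rightarrow> nat \<Rightarrow> complex mat" where
  "schur_power A m = map_mat (\<lambda>z. z ^ m) A"

definition kron_mat :: "complex mat \<Rightarrow> complex mat \<Rightarrow> complex mat" where
  "kron_mat A B = Matrix.mat (dim_row A * dim_row B) (dim_col A * dim_col B)
     (\<lambda>(i, j). A $$ (i div dim_row B, j div dim_col B) * B $$ (i mod dim_row B, j mod dim_col B))"

definition kron_vec :: "complex vec \<Rightarrow> complex vec \<Rightarrow> complex vec" where
  "kron_vec x y = Matrix.vec (dim_vec x * dim_vec y)
     (\<lambda>i. x $ (i div dim_vec y) * y $ (i mod dim_vec y))"

text \<open>Iterated products. The index of the first factor is the most significant digit in base
  \<open>n\<close>, for matrices and vectors alike, and the empty product is one-dimensional.\<close>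

definition kron_power :: "complex mat \<Rightarrow> nat \<Rightarrow> complex mat" where
  "kron_power A m = foldr kron_mat (replicate m A) (1\<^sub>m 1)"

definition kron_vecs :: "complex vec list \<Rightarrow> complex vec" where
  "kron_vecs xs = foldr kron_vec xs (Matrix.vec 1 (\<lambda>_. 1))"

definition unitary_mat :: "nat \<Rightarrow> complex mat \<Rightarrow> bool" where
  "unitary_mat n U \<longleftrightarrow> U \<in> carrier_mat n n \<and>
     mat_adjoint U * U = 1\<^sub>m n \<and> U * mat_adjoint U = 1\<^sub>m n"

definition span_vec :: "nat \<Rightarrow> complex vec set \<Rightarrow> complex vec set" where
  "span_vec N S = LinearCombinations.module.span class_ring (module_vec TYPE(complex) N) S"

definition column_tensor_span :: "nat \<Rightarrow> nat \<Rightarrow> nat \<Rightarrow> complex mat \<Rightarrow> complex vec set" where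
  "column_tensor_span n m k U =
     span_vec (n ^ m) {kron_vecs (map (col U) js) | js. length js = m \<and> set js \<subseteq> {..<k}}"

definition diagonal_tensor_span :: "nat \<Rightarrow> nat \<Rightarrow> complex vec set" where
  "diagonal_tensor_span n m =
     span_vec (n ^ m) {kron_vecs (replicate m (unit_vec n j)) | j. j < n}"

end

theory Submission
  imports
    "HOL-Analysis.Function_Topology"
    "HOL-Analysis.L2_Norm"
    "Jordan_Normal_Form.Spectral_Radius"
    Defs
begin

text \<open>
  Write \<open>C = numerical_radius A = spectral_norm A\<close>. Everything rests on equality in the
  Cauchy--Schwarz inequality. By compactness the numerical radius is attained at some unit vector
  \<open>x\<close>, and \<open>\<bar>\<langle>A x, x\<rangle>\<bar> = C \<ge> \<parallel>A x\<parallel>\<close> forces \<open>x\<close> to be an eigenvector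
  (\<open>op_norm_le_attained_eigenvector\<close>); hence the largest modulus of an eigenvalue is \<open>C\<close>. In turn, an
  eigenvector whose eigenvalue \<open>c\<close> has modulus \<open>C\<close> is an eigenvector of the adjoint, with eigenvalue
  the conjugate of \<open>c\<close> (\<open>op_norm_le_adjoint_eigenvector\<close>). So it is orthogonal to the range of
  \<open>A - c\<close>, which excludes a Jordan block of size two or more for \<open>c\<close>.

  For the powers, let \<open>G = diagonal_embedding n m\<close> be the isometry with \<open>G e\<^sub>j = e\<^sub>j \<otimes> \<dots> \<otimes> e\<^sub>j\<close>. Its range is the diagonal tensor
  span, the Schur power of \<open>A\<close> is the compression by \<open>G\<close> of the Kronecker power \<open>K\<close> of \<open>A\<close>
  (\<open>schur_power_compression\<close>), and \<open>\<parallel>K\<parallel> \<le> C ^ m\<close> (\<open>op_norm_le_kron_mat\<close>). The equality case above,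
  applied to \<open>K\<close>, shows that the Schur power has numerical radius \<open>C ^ m\<close> exactly if the range of
  \<open>G\<close> contains an eigenvector of \<open>K\<close> with eigenvalue of modulus \<open>C ^ m\<close>
  (\<open>numerical_radius_schur_power_eq_iff\<close>).

  It remains to relate such eigenvectors to the tensors of the first \<open>k\<close> columns \<open>u\<^sub>j\<close> of \<open>U\<close>. These
  tensors are eigenvectors of \<open>K\<close>, and therefore of its adjoint, with eigenvalues of modulus
  \<open>C ^ m\<close>; an eigenvector of \<open>K\<close> whose eigenvalue has another modulus is orthogonal to all of them
  (\<open>column_tensor_span_eigenvalue\<close>). Conversely, if some factor \<open>u\<^sub>j\<close> of a tensor of columns has
  \<open>j \<ge> k\<close>, then \<open>A\<^sup>p u\<^sub>j / C\<^sup>p\<close> tends to zero, because the block \<open>A'\<close> has spectral radius below \<open>C\<close>.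
  Moving the \<open>p\<close>-th power of \<open>K\<close> between the tensor and an eigenvector \<open>v\<close> with eigenvalue of modulus
  \<open>C ^ m\<close> shows that the two are orthogonal (\<open>decaying_factor_orthogonal\<close>), so \<open>v\<close> lies in the
  span of the remaining tensors.

  The passage from \<open>m\<close> to smaller exponents contracts the first tensor factor of an eigenvector \<open>G x\<close>
  with a vector \<open>y\<close> supported where \<open>x\<close> is nonzero. If \<open>y\<close> is an eigenvector of the corresponding
  principal submatrix of the adjoint of \<open>A\<close>, the contraction is an eigenvector of the next lower
  Kronecker power, lies in the diagonal tensor span, and norm estimates determine the modulus of its
  eigenvalue (\<open>diagonal_eigenvector_descent\<close>).
\<close>

section \<open>Inner products, norm bounds and the equality case of Cauchy--Schwarz\<close>

lemma cinner_sum: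
  assumes "y \<in> carrier_vec n"
  shows "x \<bullet>c y = (\<Sum>i<n. x $ i * cnj (y $ i))"
  using assms by (auto simp: scalar_prod_def lessThan_atLeast0 intro!: sum.cong)

lemma euclid_norm_L2: "euclid_norm x = L2_set (\<lambda>i. cmod (x $ i)) {..<dim_vec x}"
  by (simp add: euclid_norm_def L2_set_def)

lemma euclid_norm_nonneg [simp]: "0 \<le> euclid_norm x"
  by (simp add: euclid_norm_def sum_nonneg)

lemma euclid_norm_square: "(euclid_norm x)\<^sup>2 = (\<Sum>i<dim_vec x. (cmod (x $ i))\<^sup>2)"
  by (simp add: euclid_norm_def sum_nonneg)

lemma cinner_self: "x \<bullet>c x = complex_of_real ((euclid_norm x)\<^sup>2)"
  unfolding euclid_norm_square cinner_sum[OF carrier_vec_dim_vec] complex_norm_square of_real_sum ..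

lemma euclid_norm_eq_0_iff: "x \<in> carrier_vec n \<Longrightarrow> euclid_norm x = 0 \<longleftrightarrow> x = 0\<^sub>v n"
  by (auto simp: euclid_norm_L2 L2_set_eq_0_iff)

lemma euclid_norm_pos:
  assumes "x \<in> carrier_vec n" "x \<noteq> 0\<^sub>v n"
  shows "euclid_norm x > 0"
  using assms euclid_norm_eq_0_iff[of x n] euclid_norm_nonneg[of x] by (simp add: less_le)

lemma cinner_zero_left [simp]: "y \<in> carrier_vec n \<Longrightarrow> 0\<^sub>v n \<bullet>c y = 0"
  by (simp add: cinner_sum)

lemma cinner_add_left:
  fixes x y z :: "complex vec"
  assumes "x \<in> carrier_vec n" "y \<in> carrier_vec n" "z \<in> carrier_vec n"
  shows "(x + y) \<bullet>c z = x \<bullet>c z + y \<bullet>c z"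
  unfolding cinner_sum[OF assms(3)] sum.distrib[symmetric]
  by (rule sum.cong) (use assms in \<open>auto simp: distrib_right\<close>)

lemma cinner_minus_left:
  fixes x y z :: "complex vec"
  assumes "x \<in> carrier_vec n" "y \<in> carrier_vec n" "z \<in> carrier_vec n"
  shows "(x - y) \<bullet>c z = x \<bullet>c z - y \<bullet>c z"
  unfolding cinner_sum[OF assms(3)] sum_subtractf[symmetric]
  by (rule sum.cong) (use assms in \<open>auto simp: left_diff_distrib\<close>)

lemma cinner_minus_right:
  fixes x y z :: "complex vec"
  assumes "x \<in> carrier_vec n" "y \<in> carrier_vec n" "z \<in> carrier_vec n"
  shows "z \<bullet>c (x - y) = z \<bullet>c x - z \<bullet>c y"
  unfolding cinner_sum[OF assms(1)] cinner_sum[OF assms(2)]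
    cinner_sum[OF minus_carrier_vec[OF assms(1,2)]] sum_subtractf[symmetric]
  by (rule sum.cong) (use assms in \<open>auto simp: right_diff_distrib\<close>)

lemma cinner_smult_left:
  assumes "x \<in> carrier_vec n" "y \<in> carrier_vec n"
  shows "(c \<cdot>\<^sub>v x) \<bullet>c y = c * (x \<bullet>c y)"
  using assms by (simp add: cinner_sum sum_distrib_left mult_ac)

lemma cinner_smult_right:
  assumes "x \<in> carrier_vec n" "y \<in> carrier_vec n"
  shows "x \<bullet>c (c \<cdot>\<^sub>v y) = cnj c * (x \<bullet>c y)"
  using assms by (simp add: cinner_sum[where n=n] sum_distrib_left mult_ac)

lemma cinner_commute:
  assumes "x \<in> carrier_vec n" "y \<in> carrier_vec n"
  shows "y \<bullet>c x = cnj (x \<bullet>c y)"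
  using assms by (simp add: cinner_sum[where n=n] mult_ac)

lemma euclid_norm_smult: "euclid_norm (c \<cdot>\<^sub>v x) = cmod c * euclid_norm x"
  unfolding euclid_norm_L2 by (simp add: L2_set_right_distrib norm_mult cong: L2_set_cong_simp)

lemma Cauchy_Schwarz_cinner:
  assumes "x \<in> carrier_vec n" "y \<in> carrier_vec n"
  shows "cmod (x \<bullet>c y) \<le> euclid_norm x * euclid_norm y"
proof -
  have "cmod (x \<bullet>c y) \<le> (\<Sum>i<n. \<bar>cmod (x $ i)\<bar> * \<bar>cmod (y $ i)\<bar>)"
    unfolding cinner_sum[OF assms(2)]
    by (rule order_trans[OF norm_sum]) (simp add: norm_mult)
  also have "\<dots> \<le> euclid_norm x * euclid_norm y"
    using assms L2_set_mult_ineq[of "\<lambda>i. cmod (x $ i)" "\<lambda>i. cmod (y $ i)" "{..<n}"]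
    by (simp add: euclid_norm_L2)
  finally show ?thesis .
qed

lemma cinner_ext:
  fixes x y :: "complex vec"
  assumes "x \<in> carrier_vec n" "y \<in> carrier_vec n"
    and "\<And>w. w \<in> carrier_vec n \<Longrightarrow> x \<bullet>c w = y \<bullet>c w"
  shows "x = y"
proof -
  have c: "x - y \<in> carrier_vec n" using assms by simp
  have "(x - y) \<bullet>c (x - y) = 0"
    using cinner_minus_left[OF assms(1,2) c] assms(3)[OF c] by simp
  then have "euclid_norm (x - y) = 0" by (simp add: cinner_self)
  then have "x - y = 0\<^sub>v n" using euclid_norm_eq_0_iff[OF c] by simp
  then show ?thesis using assms(1,2)
    by (metis eq_iff_diff_eq_0 index_minus_vec(1) index_zero_vec(1) carrier_vecD eq_vecI)
qed

lemma adjoint_carrier [simp]: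
  "A \<in> carrier_mat n m \<Longrightarrow> mat_adjoint A \<in> carrier_mat m n"
  by (auto simp: mat_adjoint_def)

lemma adjoint_index:
  fixes A :: "complex mat"
  assumes "A \<in> carrier_mat n m" "i < m" "j < n"
  shows "mat_adjoint A $$ (i, j) = cnj (A $$ (j, i))"
  using assms by (simp add: mat_adjoint_def mat_of_rows_index)

lemma mult_mat_vec_index:
  assumes "A \<in> carrier_mat n m" "x \<in> carrier_vec m" "i < n"
  shows "(A *\<^sub>v x) $ i = (\<Sum>j<m. A $$ (i, j) * x $ j)"
  using assms by (auto simp: scalar_prod_def lessThan_atLeast0 intro!: sum.cong)

lemma mult_mat_zero_vec:
  fixes A :: "complex mat"
  assumes "A \<in> carrier_mat n m"
  shows "A *\<^sub>v 0\<^sub>v m = 0\<^sub>v n"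
  by (rule eq_vecI) (use assms in \<open>auto simp: scalar_prod_def\<close>)

lemma mult_mat_unit_vec:
  fixes A :: "complex mat"
  assumes "A \<in> carrier_mat n m" "j < m"
  shows "A *\<^sub>v unit_vec m j = col A j"
  by (rule eq_vecI) (use assms in auto)

lemma cinner_adjoint:
  fixes A :: "complex mat"
  assumes A: "A \<in> carrier_mat n m" and x: "x \<in> carrier_vec m" and y: "y \<in> carrier_vec n"
  shows "(A *\<^sub>v x) \<bullet>c y = x \<bullet>c (mat_adjoint A *\<^sub>v y)"
proof -
  have A': "mat_adjoint A \<in> carrier_mat m n" using A by simp
  have c: "mat_adjoint A *\<^sub>v y \<in> carrier_vec m" using A' y by simp
  have "(A *\<^sub>v x) \<bullet>c y = (\<Sum>i<n. \<Sum>j<m. A $$ (i, j) * x $ j * cnj (y $ i))"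
    unfolding cinner_sum[OF y] by (simp add: mult_mat_vec_index[OF A x] sum_distrib_right)
  also have "\<dots> = (\<Sum>j<m. \<Sum>i<n. A $$ (i, j) * x $ j * cnj (y $ i))"
    by (rule sum.swap)
  also have "\<dots> = x \<bullet>c (mat_adjoint A *\<^sub>v y)"
    unfolding cinner_sum[OF c]
    by (simp add: mult_mat_vec_index[OF A' y] adjoint_index[OF A] sum_distrib_left mult_ac)
  finally show ?thesis .
qed

text \<open>An upper bound on the operator norm, as a relation: Kronecker powers then need only bounds and
  never the value of a supremum.\<close>

definition op_norm_le :: "complex mat \<Rightarrow> real \<Rightarrow> bool" where
  "op_norm_le A C \<longleftrightarrow>
     (\<forall>x \<in> carrier_vec (dim_col A). euclid_norm (A *\<^sub>v x) \<le> C * euclid_norm x)"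

lemma op_norm_leD:
  "\<lbrakk>op_norm_le A C; A \<in> carrier_mat n m; x \<in> carrier_vec m\<rbrakk>
   \<Longrightarrow> euclid_norm (A *\<^sub>v x) \<le> C * euclid_norm x"
  by (auto simp: op_norm_le_def)

text \<open>The adjoint has the same operator norm, so \<open>\<parallel>A\<^sup>* x\<parallel> \<le> \<bar>c\<bar> \<parallel>x\<parallel>\<close>. Expanding the square of
  \<open>A\<^sup>* x - cnj c x\<close>, both cross terms equal \<open>\<bar>c\<bar>\<^sup>2 \<parallel>x\<parallel>\<^sup>2\<close>, so the square is at most zero.\<close>

lemma op_norm_le_adjoint_eigenvector:
  assumes A: "A \<in> carrier_mat n n" and b: "op_norm_le A (cmod c)"
    and x: "x \<in> carrier_vec n" and e: "A *\<^sub>v x = c \<cdot>\<^sub>v x"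
  shows "mat_adjoint A *\<^sub>v x = cnj c \<cdot>\<^sub>v x"
proof -
  let ?y = "mat_adjoint A *\<^sub>v x"
  have y: "?y \<in> carrier_vec n" using A x by (metis adjoint_carrier mult_mat_vec_carrier)
  define d where "d = ?y - cnj c \<cdot>\<^sub>v x"
  have d: "d \<in> carrier_vec n" using y x by (simp add: d_def)
  have xy: "x \<bullet>c ?y = c * (x \<bullet>c x)"
    using cinner_adjoint[OF A x x] e cinner_smult_left[OF x x] by simp
  have yx: "?y \<bullet>c x = cnj c * (x \<bullet>c x)"
    using cinner_commute[OF x y] xy by (simp add: cinner_self)
  have "euclid_norm ?y * euclid_norm ?y = cmod (?y \<bullet>c ?y)"
    by (simp only: cinner_self norm_of_real) (simp add: power2_eq_square)
  also have "?y \<bullet>c ?y = (A *\<^sub>v ?y) \<bullet>c x"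
    using cinner_adjoint[OF A y x] by simp
  also have "cmod \<dots> \<le> (cmod c * euclid_norm ?y) * euclid_norm x"
    using Cauchy_Schwarz_cinner[of "A *\<^sub>v ?y" n x] A x y op_norm_leD[OF b A y]
    by (meson mult_mat_vec_carrier order_trans mult_right_mono euclid_norm_nonneg)
  finally have "euclid_norm ?y * euclid_norm ?y \<le> (cmod c * euclid_norm x) * euclid_norm ?y"
    by (simp add: mult_ac)
  then have le: "euclid_norm ?y \<le> cmod c * euclid_norm x"
    by (metis euclid_norm_nonneg less_eq_real_def mult_le_cancel_right mult_nonneg_nonneg norm_ge_zero
        antisym)
  have "d \<bullet>c d = ?y \<bullet>c ?y - c * (?y \<bullet>c x) - cnj c * (x \<bullet>c ?y) + c * cnj c * (x \<bullet>c x)"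
    using x y d unfolding d_def
    by (simp add: cinner_minus_left[where n=n] cinner_minus_right[where n=n]
        cinner_smult_left[where n=n] cinner_smult_right[where n=n] algebra_simps)
  also have "\<dots> = ?y \<bullet>c ?y - c * cnj c * (x \<bullet>c x)"
    by (simp add: xy yx)
  also have "\<dots> = complex_of_real ((euclid_norm ?y)\<^sup>2 - (cmod c * euclid_norm x)\<^sup>2)"
    by (simp only: cinner_self complex_norm_square[symmetric] power_mult_distrib of_real_mult of_real_diff)
  finally have "(euclid_norm d)\<^sup>2 = (euclid_norm ?y)\<^sup>2 - (cmod c * euclid_norm x)\<^sup>2"
    by (simp only: cinner_self of_real_eq_iff)
  also have "\<dots> \<le> 0" using power_mono[OF le, of 2] by simp
  finally have "euclid_norm d = 0" by simp
  then have "d = 0\<^sub>v n" using euclid_norm_eq_0_iff[OF d] by simp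
  then show ?thesis using x y unfolding d_def
    by (metis eq_iff_diff_eq_0 index_minus_vec(1) index_zero_vec(1) carrier_vecD eq_vecI smult_carrier_vec)
qed

text \<open>The equality case of Cauchy--Schwarz: with \<open>c = \<langle>A x, x\<rangle>\<close>, the vector \<open>A x - c x\<close> has squared norm
  \<open>\<parallel>A x\<parallel>\<^sup>2 - \<bar>c\<bar>\<^sup>2\<close>, which is at most \<open>0\<close> since \<open>\<bar>c\<bar>\<close> is the upper bound.\<close>

lemma op_norm_le_attained_eigenvector:
  assumes A: "A \<in> carrier_mat n n" and b: "op_norm_le A C"
    and x: "x \<in> carrier_vec n" "euclid_norm x = 1"
    and e: "cmod ((A *\<^sub>v x) \<bullet>c x) = C"
  shows "A *\<^sub>v x = ((A *\<^sub>v x) \<bullet>c x) \<cdot>\<^sub>v x"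
proof -
  define y where "y = A *\<^sub>v x"
  define c where "c = y \<bullet>c x"
  have y: "y \<in> carrier_vec n" using A x by (simp add: y_def)
  define d where "d = y - c \<cdot>\<^sub>v x"
  have d: "d \<in> carrier_vec n" using y x by (simp add: d_def)
  have xy: "x \<bullet>c y = cnj c" using cinner_commute[OF y x(1)] by (simp add: c_def)
  have le: "euclid_norm y \<le> cmod c" using op_norm_leD[OF b A x(1)] x e
    by (simp add: y_def c_def)
  have "d \<bullet>c d = y \<bullet>c y - cnj c * (y \<bullet>c x) - c * (x \<bullet>c y) + c * cnj c * (x \<bullet>c x)"
    using x y d unfolding d_def
    by (simp add: cinner_minus_left[where n=n] cinner_minus_right[where n=n]
        cinner_smult_left[where n=n] cinner_smult_right[where n=n] algebra_simps)
  also have "\<dots> = y \<bullet>c y - c * cnj c"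
    using x by (simp add: xy c_def[symmetric] cinner_self)
  also have "\<dots> = complex_of_real ((euclid_norm y)\<^sup>2 - (cmod c)\<^sup>2)"
    by (simp only: cinner_self complex_norm_square[symmetric] power_mult_distrib of_real_mult of_real_diff)
  finally have "(euclid_norm d)\<^sup>2 = (euclid_norm y)\<^sup>2 - (cmod c)\<^sup>2"
    by (simp only: cinner_self of_real_eq_iff)
  also have "\<dots> \<le> 0" using power_mono[OF le, of 2] by simp
  finally have "euclid_norm d = 0" by simp
  then have "d = 0\<^sub>v n" using euclid_norm_eq_0_iff[OF d] by simp
  then have "y = c \<cdot>\<^sub>v x" using x y unfolding d_def
    by (metis eq_iff_diff_eq_0 index_minus_vec(1) index_zero_vec(1) carrier_vecD eq_vecI smult_carrier_vec)
  then show ?thesis unfolding c_def y_def .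
qed

section \<open>Attainment of the numerical radius\<close>

text \<open>With vectors as coordinate functions, extended by zero beyond the dimension, the unit sphere is a
  closed subset of a product of compact squares, so its compactness follows from Tychonoff's theorem.\<close>

lemma compact_unit_sphere_coordinates:
  "compact {f :: nat \<Rightarrow> complex. (\<forall>i\<ge>n. f i = 0) \<and> (\<Sum>i<n. (cmod (f i))\<^sup>2) = 1}"
proof -
  \<comment> \<open>the square with corners \<open>\<plusminus>1 \<plusminus> \<i>\<close>, which contains the unit disc\<close>
  let ?Q = "(\<lambda>p. complex_of_real (fst p) + \<i> * complex_of_real (snd p)) ` ({-1..1} \<times> {-1..1})"
  let ?B = "\<lambda>i. if i < n then ?Q else {0 :: complex}"
  have Q: "compact ?Q"
    by (intro compact_continuous_image continuous_intros compact_Times compact_Icc)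
  have unit_disc: "z \<in> ?Q" if "cmod z \<le> 1" for z
  proof (rule image_eqI)
    show "z = complex_of_real (fst (Re z, Im z)) + \<i> * complex_of_real (snd (Re z, Im z))"
      by (simp add: complex_eq_iff)
    show "(Re z, Im z) \<in> {-1..1} \<times> {-1..1}"
      using abs_Re_le_cmod[of z] abs_Im_le_cmod[of z] that by auto
  qed
  have "compact (?B i)" for i using Q by simp
  then have K: "compact (PiE UNIV ?B)"
    using compactin_PiE[of "\<lambda>i. euclidean" UNIV ?B]
    by (simp only: euclidean_product_topology compactin_euclidean_iff) simp
  have "closed {f :: nat \<Rightarrow> complex. (\<Sum>i<n. (cmod (f i))\<^sup>2) = 1}"
    by (intro closed_Collect_eq continuous_intros continuous_on_product_coordinates)
  from compact_Int_closed[OF K this] have "compact (PiE UNIV ?B \<inter> {f. (\<Sum>i<n. (cmod (f i))\<^sup>2) = 1})" .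
  also have "PiE UNIV ?B \<inter> {f. (\<Sum>i<n. (cmod (f i))\<^sup>2) = 1}
      = {f. (\<forall>i\<ge>n. f i = 0) \<and> (\<Sum>i<n. (cmod (f i))\<^sup>2) = 1}"
  proof (intro equalityI subsetI)
    fix f :: "nat \<Rightarrow> complex"
    assume f: "f \<in> {f. (\<forall>i\<ge>n. f i = 0) \<and> (\<Sum>i<n. (cmod (f i))\<^sup>2) = 1}"
    have "cmod (f i) \<le> 1" if "i < n" for i
    proof -
      have "(cmod (f i))\<^sup>2 \<le> (\<Sum>i<n. (cmod (f i))\<^sup>2)"
        by (rule member_le_sum) (use that in auto)
      then show ?thesis using f by (simp add: abs_square_le_1)
    qed
    then show "f \<in> PiE UNIV ?B \<inter> {f. (\<Sum>i<n. (cmod (f i))\<^sup>2) = 1}"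
      using f unit_disc by auto
  next
    fix f assume f: "f \<in> PiE UNIV ?B \<inter> {f. (\<Sum>i<n. (cmod (f i))\<^sup>2) = 1}"
    have "f i = 0" if "i \<ge> n" for i
      using PiE_mem[of f UNIV ?B i] f that by simp
    then show "f \<in> {f. (\<forall>i\<ge>n. f i = 0) \<and> (\<Sum>i<n. (cmod (f i))\<^sup>2) = 1}"
      using f by simp
  qed
  finally show ?thesis .
qed

text \<open>A continuous function attains its supremum on the compact unit sphere. The dimension must be
  positive for the sphere to be nonempty.\<close>

lemma numerical_radius_attained:
  assumes A: "A \<in> carrier_mat n n" and n: "n \<ge> 1"
  shows numerical_radius_max_vector:
      "\<exists>x \<in> carrier_vec n. euclid_norm x = 1 \<and> cmod ((A *\<^sub>v x) \<bullet>c x) = numerical_radius A"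
    and numerical_radius_upper:
      "\<And>x. \<lbrakk>x \<in> carrier_vec n; euclid_norm x = 1\<rbrakk>
        \<Longrightarrow> cmod ((A *\<^sub>v x) \<bullet>c x) \<le> numerical_radius A"
proof -
  let ?S = "{f :: nat \<Rightarrow> complex. (\<forall>i\<ge>n. f i = 0) \<and> (\<Sum>i<n. (cmod (f i))\<^sup>2) = 1}"
  let ?g = "\<lambda>f :: nat \<Rightarrow> complex. cmod (\<Sum>i<n. (\<Sum>j<n. A $$ (i, j) * f j) * cnj (f i))"
  have "(\<Sum>i<n. (cmod (if i = 0 then 1 else 0))\<^sup>2) = (\<Sum>i<n. if i = 0 then 1 else 0 :: real)"
    by (rule sum.cong) auto
  also have "\<dots> = 1" using n by (subst sum.delta) auto
  finally have "(\<lambda>i. if i = 0 then 1 else 0) \<in> ?S" using n by simp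
  then have ne: "?S \<noteq> {}" by (intro ex_in_conv[THEN iffD1] exI)
  have cont: "continuous_on ?S ?g"
    by (intro continuous_intros continuous_on_subset[OF continuous_on_product_coordinates]) auto
  obtain f where f: "f \<in> ?S" and max: "\<And>h. h \<in> ?S \<Longrightarrow> ?g h \<le> ?g f"
    using continuous_attains_sup[OF compact_unit_sphere_coordinates ne cont] by blast
  have g: "cmod ((A *\<^sub>v x) \<bullet>c x) = ?g (\<lambda>i. if i < n then x $ i else 0)"
    and S: "euclid_norm x = 1 \<Longrightarrow> (\<lambda>i. if i < n then x $ i else 0) \<in> ?S"
    if x: "x \<in> carrier_vec n" for x
    using x euclid_norm_square[of x] by (auto simp: cinner_sum[OF x] mult_mat_vec_index[OF A x])
  define x where "x = vec n f"
  have x: "x \<in> carrier_vec n" by (simp add: x_def)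
  have x1: "euclid_norm x = 1" using f by (simp add: euclid_norm_def x_def)
  have gx: "cmod ((A *\<^sub>v x) \<bullet>c x) = ?g f"
    unfolding g[OF x] by (simp add: x_def)
  have up: "cmod ((A *\<^sub>v y) \<bullet>c y) \<le> cmod ((A *\<^sub>v x) \<bullet>c x)"
    if "y \<in> carrier_vec n" "euclid_norm y = 1" for y
    unfolding gx g[OF that(1)] by (rule max[OF S[OF that]])
  have eq: "numerical_radius A = cmod ((A *\<^sub>v x) \<bullet>c x)"
    unfolding numerical_radius_def
    by (rule cSup_eq_maximum) (use A x x1 up in auto)
  show "\<exists>x \<in> carrier_vec n. euclid_norm x = 1 \<and> cmod ((A *\<^sub>v x) \<bullet>c x) = numerical_radius A"
    using x x1 eq by auto
  show "cmod ((A *\<^sub>v y) \<bullet>c y) \<le> numerical_radius A"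
    if "y \<in> carrier_vec n" "euclid_norm y = 1" for y
    using up[OF that] eq by simp
qed

lemma unit_multiple:
  assumes x: "x \<in> carrier_vec n" and "x \<noteq> 0\<^sub>v n"
  obtains y r where "y \<in> carrier_vec n" "euclid_norm y = 1" "r > 0" "x = complex_of_real r \<cdot>\<^sub>v y"
    "r = euclid_norm x"
proof -
  define r where "r = euclid_norm x"
  have r: "r > 0" using assms euclid_norm_eq_0_iff[OF x] euclid_norm_nonneg[of x]
    by (simp add: r_def less_le)
  show thesis
    by (rule that[of "complex_of_real (1 / r) \<cdot>\<^sub>v x" r])
      (use r x in \<open>auto simp: euclid_norm_smult smult_smult_assoc norm_divide r_def[symmetric]\<close>)
qed

lemma numerical_radius_quadratic_form:
  assumes A: "A \<in> carrier_mat n n" and n: "n \<ge> 1" and x: "x \<in> carrier_vec n"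
  shows "cmod ((A *\<^sub>v x) \<bullet>c x) \<le> numerical_radius A * (euclid_norm x)\<^sup>2"
proof (cases "x = 0\<^sub>v n")
  case True
  then show ?thesis using A euclid_norm_eq_0_iff[of "0\<^sub>v n" n] by simp
next
  case False
  obtain y r where y: "y \<in> carrier_vec n" "euclid_norm y = 1" and r: "r > 0"
    and xy: "x = complex_of_real r \<cdot>\<^sub>v y" "r = euclid_norm x"
    using unit_multiple[OF x False] by blast
  have Ay: "A *\<^sub>v y \<in> carrier_vec n" using A y by simp
  have "(A *\<^sub>v x) \<bullet>c x = complex_of_real (r\<^sup>2) * ((A *\<^sub>v y) \<bullet>c y)"
    using A y Ay by (simp add: xy(1) mult_mat_vec cinner_smult_left[where n=n]
        cinner_smult_right[where n=n] power2_eq_square)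
  then have "cmod ((A *\<^sub>v x) \<bullet>c x) = r\<^sup>2 * cmod ((A *\<^sub>v y) \<bullet>c y)"
    by (simp add: norm_mult norm_power)
  also have "\<dots> \<le> r\<^sup>2 * numerical_radius A"
    by (intro mult_left_mono numerical_radius_upper[OF A n y]) simp
  finally show ?thesis by (simp add: xy(2) mult_ac)
qed

text \<open>Cauchy--Schwarz in each row gives a finite bound, which makes the supremum in the spectral norm
  meaningful.\<close>

lemma op_norm_le_exists:
  assumes A: "A \<in> carrier_mat n m"
  shows "\<exists>C. op_norm_le A C"
proof
  show "op_norm_le A (\<Sum>i<n. euclid_norm (conjugate (row A i)))"
    unfolding op_norm_le_def
  proof
    fix x :: "complex vec" assume "x \<in> carrier_vec (dim_col A)"
    then have x: "x \<in> carrier_vec m" using A by simp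
    have "euclid_norm (A *\<^sub>v x) \<le> (\<Sum>i<n. cmod ((A *\<^sub>v x) $ i))"
      using A L2_set_le_sum[of "{..<n}" "\<lambda>i. cmod ((A *\<^sub>v x) $ i)"] by (simp add: euclid_norm_L2)
    also have "\<dots> \<le> (\<Sum>i<n. euclid_norm (conjugate (row A i)) * euclid_norm x)"
    proof (rule sum_mono)
      fix i assume "i \<in> {..<n}"
      then have i: "i < n" by simp
      have r: "row A i \<in> carrier_vec m" using A i by simp
      have "cmod ((A *\<^sub>v x) $ i) = cmod (x \<bullet>c conjugate (row A i))"
        using A i x r by (simp add: comm_scalar_prod[of _ m])
      also have "\<dots> \<le> euclid_norm x * euclid_norm (conjugate (row A i))"
        by (rule Cauchy_Schwarz_cinner) (use x r in auto)
      finally show "cmod ((A *\<^sub>v x) $ i) \<le> euclid_norm (conjugate (row A i)) * euclid_norm x"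
        by (simp add: mult_ac)
    qed
    finally show "euclid_norm (A *\<^sub>v x) \<le> (\<Sum>i<n. euclid_norm (conjugate (row A i))) * euclid_norm x"
      by (simp add: sum_distrib_right)
  qed
qed

lemma op_norm_le_spectral_norm:
  fixes A :: "complex mat"
  assumes A: "A \<in> carrier_mat n m"
  shows "op_norm_le A (spectral_norm A)"
  unfolding op_norm_le_def
proof
  let ?S = "{euclid_norm (A *\<^sub>v x) | x. x \<in> carrier_vec (dim_col A) \<and> euclid_norm x = 1}"
  fix x :: "complex vec" assume x: "x \<in> carrier_vec (dim_col A)"
  obtain C where C: "op_norm_le A C" using op_norm_le_exists[OF A] by blast
  have bdd: "bdd_above ?S"
    by (rule bdd_aboveI[of _ C]) (use C in \<open>auto simp: op_norm_le_def\<close>)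
  show "euclid_norm (A *\<^sub>v x) \<le> spectral_norm A * euclid_norm x"
  proof (cases "x = 0\<^sub>v (dim_col A)")
    case True
    have "A *\<^sub>v x = 0\<^sub>v (dim_row A)" unfolding True by (intro eq_vecI) (auto simp: scalar_prod_def)
    then show ?thesis using euclid_norm_eq_0_iff[OF x] True
        euclid_norm_eq_0_iff[of "0\<^sub>v (dim_row A)" "dim_row A"] by simp
  next
    case False
    obtain y r where y: "y \<in> carrier_vec (dim_col A)" "euclid_norm y = 1" and r: "r > 0"
      and xy: "x = complex_of_real r \<cdot>\<^sub>v y" "r = euclid_norm x"
      using unit_multiple[OF x False] by blast
    have "euclid_norm (A *\<^sub>v y) \<le> spectral_norm A"
      unfolding spectral_norm_def by (rule cSup_upper[OF _ bdd]) (use y in blast)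
    moreover have "A *\<^sub>v x = complex_of_real r \<cdot>\<^sub>v (A *\<^sub>v y)"
      using mult_mat_vec[of A n "dim_col A" y] A y by (simp add: xy(1))
    then have "euclid_norm (A *\<^sub>v x) = r * euclid_norm (A *\<^sub>v y)"
      using r by (simp add: euclid_norm_smult)
    ultimately show ?thesis using r by (simp add: xy(2)[symmetric] mult.commute)
  qed
qed

section \<open>Kronecker products\<close>

text \<open>A Kronecker product is indexed by a single number whose quotient and remainder are the indices of
  the two factors; this converts sums over that number to double sums.\<close>

lemma sum_div_mod:
  "(\<Sum>i<a * b. f (i div b) (i mod b)) = (\<Sum>p<a. \<Sum>q<b. f p (q :: nat))"
proof -
  have "(\<Sum>i<a * b. f (i div b) (i mod b))
      = (\<Sum>p<a. \<Sum>i = p * b..<p * b + b. f (i div b) (i mod b))"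
    by (rule sum.nat_group[symmetric])
  also have "\<dots> = (\<Sum>p<a. \<Sum>q<b. f p q)"
  proof (rule sum.cong[OF refl])
    fix p
    have "(\<Sum>i = p * b..<p * b + b. f (i div b) (i mod b))
        = (\<Sum>q\<in>{0..<b}. f ((q + p * b) div b) ((q + p * b) mod b))"
      using sum.shift_bounds_nat_ivl[of "\<lambda>i. f (i div b) (i mod b)" 0 "p * b" b]
      by (simp add: add.commute)
    also have "\<dots> = (\<Sum>q<b. f p q)"
      by (rule sum.cong) auto
    finally show "(\<Sum>i = p * b..<p * b + b. f (i div b) (i mod b)) = (\<Sum>q<b. f p q)" .
  qed
  finally show ?thesis .
qed

lemma div_mod_less:
  assumes "i < a * (b :: nat)"
  shows "i div b < a" "i mod b < b"
  using assms by (auto simp: less_mult_imp_div_less intro!: mod_less_divisor gr0I)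

lemma kron_vec_carrier [simp]:
  "\<lbrakk>x \<in> carrier_vec a; y \<in> carrier_vec b\<rbrakk> \<Longrightarrow> kron_vec x y \<in> carrier_vec (a * b)"
  by (simp add: kron_vec_def)

lemma kron_vec_index:
  "\<lbrakk>x \<in> carrier_vec a; y \<in> carrier_vec b; i < a * b\<rbrakk>
   \<Longrightarrow> kron_vec x y $ i = x $ (i div b) * y $ (i mod b)"
  by (simp add: kron_vec_def)

lemma kron_mat_carrier [simp]:
  "\<lbrakk>A \<in> carrier_mat a b; B \<in> carrier_mat c d\<rbrakk> \<Longrightarrow> kron_mat A B \<in> carrier_mat (a * c) (b * d)"
  by (simp add: kron_mat_def)

lemma kron_mat_index:
  "\<lbrakk>A \<in> carrier_mat a b; B \<in> carrier_mat c d; i < a * c; j < b * d\<rbrakk>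
   \<Longrightarrow> kron_mat A B $$ (i, j) = A $$ (i div c, j div d) * B $$ (i mod c, j mod d)"
  by (simp add: kron_mat_def)

lemma cinner_kron_vec:
  assumes "x \<in> carrier_vec a" "y \<in> carrier_vec b" "x' \<in> carrier_vec a" "y' \<in> carrier_vec b"
  shows "kron_vec x y \<bullet>c kron_vec x' y' = (x \<bullet>c x') * (y \<bullet>c y')"
proof -
  let ?f = "\<lambda>p q. (x $ p * cnj (x' $ p)) * (y $ q * cnj (y' $ q))"
  have "kron_vec x y \<bullet>c kron_vec x' y' = (\<Sum>i<a * b. ?f (i div b) (i mod b))"
    unfolding cinner_sum[OF kron_vec_carrier[OF assms(3,4)]]
    by (rule sum.cong) (use assms in \<open>auto simp: kron_vec_index mult_ac\<close>)
  also have "\<dots> = (\<Sum>p<a. \<Sum>q<b. ?f p q)" by (rule sum_div_mod)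
  also have "\<dots> = (x \<bullet>c x') * (y \<bullet>c y')"
    unfolding cinner_sum[OF assms(3)] cinner_sum[OF assms(4)] sum_product ..
  finally show ?thesis .
qed

lemma euclid_norm_kron_vec:
  "euclid_norm (kron_vec x y) = euclid_norm x * euclid_norm y"
proof -
  have "complex_of_real ((euclid_norm (kron_vec x y))\<^sup>2)
      = complex_of_real ((euclid_norm x * euclid_norm y)\<^sup>2)"
    using cinner_kron_vec[of x "dim_vec x" y "dim_vec y" x y]
    by (simp only: cinner_self power_mult_distrib of_real_mult carrier_vec_dim_vec)
  then have "(euclid_norm (kron_vec x y))\<^sup>2 = (euclid_norm x * euclid_norm y)\<^sup>2"
    by (simp only: of_real_eq_iff)
  then show ?thesis
    by (rule power2_eq_imp_eq) (simp_all only: euclid_norm_nonneg mult_nonneg_nonneg)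
qed

lemma kron_mat_mult:
  assumes "A \<in> carrier_mat a b" "B \<in> carrier_mat c d" "A' \<in> carrier_mat b e" "B' \<in> carrier_mat d f"
  shows "kron_mat A B * kron_mat A' B' = kron_mat (A * A') (B * B')"
proof (rule eq_matI)
  have K: "kron_mat A B \<in> carrier_mat (a * c) (b * d)" "kron_mat A' B' \<in> carrier_mat (b * d) (e * f)"
    "kron_mat (A * A') (B * B') \<in> carrier_mat (a * c) (e * f)"
    "A * A' \<in> carrier_mat a e" "B * B' \<in> carrier_mat c f"
    using assms by auto
  fix i j assume "i < dim_row (kron_mat (A * A') (B * B'))" "j < dim_col (kron_mat (A * A') (B * B'))"
  then have i: "i < a * c" and j: "j < e * f" using K by auto
  note ij = div_mod_less[OF i] div_mod_less[OF j]
  have mult: "(X * Y) $$ (r, s) = (\<Sum>l<q. X $$ (r, l) * Y $$ (l, s))"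
    if "X \<in> carrier_mat p q" "Y \<in> carrier_mat q t" "r < p" "s < t"
    for X Y :: "complex mat" and p q t r s
    using that by (auto simp: scalar_prod_def lessThan_atLeast0 intro!: sum.cong)
  let ?g = "\<lambda>p q. (A $$ (i div c, p) * A' $$ (p, j div f)) * (B $$ (i mod c, q) * B' $$ (q, j mod f))"
  have "(kron_mat A B * kron_mat A' B') $$ (i, j) = (\<Sum>l<b * d. ?g (l div d) (l mod d))"
    unfolding mult[OF K(1,2) i j]
    by (rule sum.cong) (use i j assms in \<open>auto simp: kron_mat_index\<close>)
  also have "\<dots> = (\<Sum>p<b. \<Sum>q<d. ?g p q)" by (rule sum_div_mod)
  also have "\<dots> = (A * A') $$ (i div c, j div f) * (B * B') $$ (i mod c, j mod f)"
    unfolding mult[OF assms(1,3) ij(1,3)] mult[OF assms(2,4) ij(2,4)] sum_product ..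
  also have "\<dots> = kron_mat (A * A') (B * B') $$ (i, j)"
    by (rule kron_mat_index[OF K(4,5) i j, symmetric])
  finally show "(kron_mat A B * kron_mat A' B') $$ (i, j) = kron_mat (A * A') (B * B') $$ (i, j)" .
qed (use assms in \<open>auto simp: kron_mat_def\<close>)

lemma kron_mat_mult_vec:
  assumes "A \<in> carrier_mat a b" "B \<in> carrier_mat c d" "x \<in> carrier_vec b" "y \<in> carrier_vec d"
  shows "kron_mat A B *\<^sub>v kron_vec x y = kron_vec (A *\<^sub>v x) (B *\<^sub>v y)"
proof (rule eq_vecI)
  have K: "kron_mat A B \<in> carrier_mat (a * c) (b * d)" "kron_vec x y \<in> carrier_vec (b * d)"
    "A *\<^sub>v x \<in> carrier_vec a" "B *\<^sub>v y \<in> carrier_vec c"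
    using assms by auto
  fix i assume "i < dim_vec (kron_vec (A *\<^sub>v x) (B *\<^sub>v y))"
  then have i: "i < a * c" using assms by (simp add: kron_vec_def)
  note ij = div_mod_less[OF i]
  let ?g = "\<lambda>p q. (A $$ (i div c, p) * x $ p) * (B $$ (i mod c, q) * y $ q)"
  have "(kron_mat A B *\<^sub>v kron_vec x y) $ i = (\<Sum>l<b * d. ?g (l div d) (l mod d))"
    unfolding mult_mat_vec_index[OF K(1,2) i]
    by (rule sum.cong) (use i assms in \<open>auto simp: kron_mat_index kron_vec_index\<close>)
  also have "\<dots> = (\<Sum>p<b. \<Sum>q<d. ?g p q)" by (rule sum_div_mod)
  also have "\<dots> = (A *\<^sub>v x) $ (i div c) * (B *\<^sub>v y) $ (i mod c)"
    unfolding mult_mat_vec_index[OF assms(1,3) ij(1)] mult_mat_vec_index[OF assms(2,4) ij(2)]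
      sum_product ..
  also have "\<dots> = kron_vec (A *\<^sub>v x) (B *\<^sub>v y) $ i"
    by (rule kron_vec_index[OF K(3,4) i, symmetric])
  finally show "(kron_mat A B *\<^sub>v kron_vec x y) $ i = kron_vec (A *\<^sub>v x) (B *\<^sub>v y) $ i" .
qed (use assms in \<open>auto simp: kron_mat_def kron_vec_def\<close>)

lemma kron_mat_adjoint:
  assumes A: "A \<in> carrier_mat a b" and B: "B \<in> carrier_mat c d"
  shows "mat_adjoint (kron_mat A B) = kron_mat (mat_adjoint A) (mat_adjoint B)"
proof (rule eq_matI)
  have K: "mat_adjoint A \<in> carrier_mat b a" "mat_adjoint B \<in> carrier_mat d c"
    using A B by auto
  fix i j
  assume "i < dim_row (kron_mat (mat_adjoint A) (mat_adjoint B))"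
    "j < dim_col (kron_mat (mat_adjoint A) (mat_adjoint B))"
  then have i: "i < b * d" and j: "j < a * c" using kron_mat_carrier[OF K] by auto
  show "mat_adjoint (kron_mat A B) $$ (i, j) = kron_mat (mat_adjoint A) (mat_adjoint B) $$ (i, j)"
    using A B i j div_mod_less[OF i] div_mod_less[OF j]
    by (simp add: adjoint_index[OF kron_mat_carrier[OF A B]] kron_mat_index[OF A B]
        kron_mat_index[OF K] adjoint_index[OF A] adjoint_index[OF B])
qed (use assms in \<open>auto simp: kron_mat_def mat_adjoint_def\<close>)

lemma kron_mat_one: "kron_mat (1\<^sub>m a) (1\<^sub>m b) = 1\<^sub>m (a * b)"
proof (rule eq_matI)
  fix i j assume "i < dim_row (1\<^sub>m (a * b) :: complex mat)" "j < dim_col (1\<^sub>m (a * b) :: complex mat)"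
  then have i: "i < a * b" and j: "j < a * b" by auto
  have "i = j \<longleftrightarrow> i div b = j div b \<and> i mod b = j mod b" by (metis div_mult_mod_eq)
  then show "kron_mat (1\<^sub>m a) (1\<^sub>m b) $$ (i, j) = 1\<^sub>m (a * b) $$ (i, j)"
    using i j div_mod_less[OF i] div_mod_less[OF j] by (auto simp: kron_mat_def)
qed (auto simp: kron_mat_def)

lemma col_kron_mat:
  assumes A: "A \<in> carrier_mat a b" and B: "B \<in> carrier_mat c d" and j: "j < b * d"
  shows "col (kron_mat A B) j = kron_vec (col A (j div d)) (col B (j mod d))"
proof (rule eq_vecI)
  fix i assume "i < dim_vec (kron_vec (col A (j div d)) (col B (j mod d)))"
  then have i: "i < a * c" using A B by (simp add: kron_vec_def)
  show "col (kron_mat A B) j $ i = kron_vec (col A (j div d)) (col B (j mod d)) $ i"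
    using A B j div_mod_less[OF i] div_mod_less[OF j] i by (simp add: kron_mat_def kron_vec_def)
qed (use A B in \<open>simp_all add: kron_mat_def kron_vec_def\<close>)

text \<open>Write the argument as a family of blocks \<open>x\<^sub>q\<close>. The product first applies \<open>B\<close> to every block,
  giving \<open>y\<^sub>q\<close>, and then \<open>A\<close> to every cross section \<open>w\<^sub>p\<close>, which collects the \<open>p\<close>-th entries of the
  \<open>y\<^sub>q\<close>. Each stage multiplies the sum of the squared norms by at most the square of its bound.\<close>

lemma op_norm_le_kron_mat:
  assumes A: "A \<in> carrier_mat a b" and B: "B \<in> carrier_mat c d"
    and nA: "op_norm_le A C" and nB: "op_norm_le B D" and C: "0 \<le> C" and D: "0 \<le> D"
  shows "op_norm_le (kron_mat A B) (C * D)"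
  unfolding op_norm_le_def
proof
  have K: "kron_mat A B \<in> carrier_mat (a * c) (b * d)" using A B by simp
  fix z :: "complex vec" assume "z \<in> carrier_vec (dim_col (kron_mat A B))"
  then have z: "z \<in> carrier_vec (b * d)" using K by simp
  define x where "x q = vec d (\<lambda>l. z $ (q * d + l))" for q
  define y where "y q = B *\<^sub>v x q" for q
  define w where "w p = vec b (\<lambda>q. y q $ p)" for p
  have x: "x q \<in> carrier_vec d" for q by (simp add: x_def)
  have y: "y q \<in> carrier_vec c" for q using B by (simp add: y_def carrier_vecI)
  have w: "w p \<in> carrier_vec b" for p by (simp add: w_def)
  have Aw: "A *\<^sub>v w p \<in> carrier_vec a" for p using A w by simp
  have Kz: "kron_mat A B *\<^sub>v z \<in> carrier_vec (a * c)" using K z by simp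
  have entry: "(kron_mat A B *\<^sub>v z) $ i = (A *\<^sub>v w (i mod c)) $ (i div c)" if i: "i < a * c" for i
  proof -
    note ij = div_mod_less[OF i]
    let ?g = "\<lambda>p q. A $$ (i div c, p) * (B $$ (i mod c, q) * x p $ q)"
    have "(kron_mat A B *\<^sub>v z) $ i = (\<Sum>l<b * d. ?g (l div d) (l mod d))"
      unfolding mult_mat_vec_index[OF K z i]
    proof (rule sum.cong[OF refl])
      fix l assume "l \<in> {..<b * d}"
      then have l: "l < b * d" by simp
      have "x (l div d) $ (l mod d) = z $ l" using div_mod_less[OF l] by (simp add: x_def)
      then show "kron_mat A B $$ (i, l) * z $ l = ?g (l div d) (l mod d)"
        using i l A B by (simp add: kron_mat_index)
    qed
    also have "\<dots> = (\<Sum>p<b. \<Sum>q<d. ?g p q)" by (rule sum_div_mod)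
    also have "\<dots> = (A *\<^sub>v w (i mod c)) $ (i div c)"
      unfolding mult_mat_vec_index[OF A w ij(1)]
      by (rule sum.cong)
        (auto simp: w_def y_def mult_mat_vec_index[OF B x ij(2)] sum_distrib_left)
    finally show ?thesis .
  qed
  have "(euclid_norm (kron_mat A B *\<^sub>v z))\<^sup>2
      = (\<Sum>i<a * c. (cmod ((A *\<^sub>v w (i mod c)) $ (i div c)))\<^sup>2)"
    using K entry unfolding euclid_norm_square by (intro sum.cong) auto
  also have "\<dots> = (\<Sum>s<a. \<Sum>p<c. (cmod ((A *\<^sub>v w p) $ s))\<^sup>2)"
    by (rule sum_div_mod[of "\<lambda>s p. (cmod ((A *\<^sub>v w p) $ s))\<^sup>2"])
  also have "\<dots> = (\<Sum>p<c. (euclid_norm (A *\<^sub>v w p))\<^sup>2)"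
    unfolding euclid_norm_square using A by (subst sum.swap) simp
  also have "\<dots> \<le> (\<Sum>p<c. (C * euclid_norm (w p))\<^sup>2)"
    by (intro sum_mono power_mono op_norm_leD[OF nA A w] euclid_norm_nonneg)
  also have "\<dots> = C\<^sup>2 * (\<Sum>p<c. \<Sum>q<b. (cmod (y q $ p))\<^sup>2)"
    by (simp add: power_mult_distrib euclid_norm_square sum_distrib_left w_def)
  also have "(\<Sum>p<c. \<Sum>q<b. (cmod (y q $ p))\<^sup>2) = (\<Sum>q<b. (euclid_norm (y q))\<^sup>2)"
    unfolding euclid_norm_square using carrier_vecD[OF y] by (subst sum.swap) simp
  also have "C\<^sup>2 * \<dots> \<le> C\<^sup>2 * (\<Sum>q<b. (D * euclid_norm (x q))\<^sup>2)"
    unfolding y_def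
    by (intro mult_left_mono sum_mono power_mono op_norm_leD[OF nB B x] euclid_norm_nonneg) simp
  also have "\<dots> = C\<^sup>2 * D\<^sup>2 * (\<Sum>q<b. \<Sum>l<d. (cmod (z $ (q * d + l)))\<^sup>2)"
    by (simp add: power_mult_distrib euclid_norm_square sum_distrib_left x_def mult.assoc)
  also have "(\<Sum>q<b. \<Sum>l<d. (cmod (z $ (q * d + l)))\<^sup>2) = (euclid_norm z)\<^sup>2"
    using z by (simp add: euclid_norm_square
        flip: sum_div_mod[of "\<lambda>q l. (cmod (z $ (q * d + l)))\<^sup>2" d b])
  finally have "(euclid_norm (kron_mat A B *\<^sub>v z))\<^sup>2 \<le> (C * D * euclid_norm z)\<^sup>2"
    by (simp add: power_mult_distrib)
  then show "euclid_norm (kron_mat A B *\<^sub>v z) \<le> C * D * euclid_norm z"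
    by (rule power2_le_imp_le) (use C D in simp)
qed

lemma kron_power_0 [simp]: "kron_power A 0 = 1\<^sub>m 1"
  and kron_power_Suc [simp]: "kron_power A (Suc m) = kron_mat A (kron_power A m)"
  by (simp_all add: kron_power_def)

lemma kron_vecs_Nil [simp]: "kron_vecs [] = vec 1 (\<lambda>_. 1)"
  and kron_vecs_Cons [simp]: "kron_vecs (x # xs) = kron_vec x (kron_vecs xs)"
  by (simp_all add: kron_vecs_def)

lemma kron_power_carrier [simp]:
  "A \<in> carrier_mat n n \<Longrightarrow> kron_power A m \<in> carrier_mat (n ^ m) (n ^ m)"
  by (induction m) auto

lemma kron_vecs_carrier:
  "set xs \<subseteq> carrier_vec n \<Longrightarrow> kron_vecs xs \<in> carrier_vec (n ^ length xs)"
  by (induction xs) auto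

lemma cinner_kron_vecs:
  assumes "length xs = length ys" "set xs \<subseteq> carrier_vec n" "set ys \<subseteq> carrier_vec n"
  shows "kron_vecs xs \<bullet>c kron_vecs ys = (\<Prod>(x, y) \<leftarrow> zip xs ys. x \<bullet>c y)"
  using assms
proof (induction xs ys rule: list_induct2)
  case Nil
  then show ?case by (simp add: cinner_sum[of _ 1])
next
  case (Cons x xs y ys)
  have "kron_vecs (x # xs) \<bullet>c kron_vecs (y # ys) = (x \<bullet>c y) * (kron_vecs xs \<bullet>c kron_vecs ys)"
    using Cons.prems kron_vecs_carrier[of xs n] kron_vecs_carrier[of ys n] Cons.hyps
    by (simp add: cinner_kron_vec[of _ n _ "n ^ length ys"])
  then show ?case using Cons by simp
qed

lemma euclid_norm_kron_vecs:
  "euclid_norm (kron_vecs xs) = (\<Prod>x\<leftarrow>xs. euclid_norm x)"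
proof (induction xs)
  case Nil
  show ?case by (simp add: euclid_norm_def)
next
  case (Cons x xs)
  then show ?case by (simp add: euclid_norm_kron_vec)
qed

lemma kron_power_mult_kron_vecs:
  assumes A: "A \<in> carrier_mat n n" and "set xs \<subseteq> carrier_vec n"
  shows "kron_power A (length xs) *\<^sub>v kron_vecs xs = kron_vecs (map (\<lambda>x. A *\<^sub>v x) xs)"
  using assms(2)
proof (induction xs)
  case (Cons x xs)
  then show ?case
    using kron_mat_mult_vec[OF A kron_power_carrier[OF A, of "length xs"], of x "kron_vecs xs"]
      kron_vecs_carrier[of xs n] by simp
qed simp

lemma kron_power_adjoint:
  assumes A: "A \<in> carrier_mat n n"
  shows "mat_adjoint (kron_power A m) = kron_power (mat_adjoint A) m"
proof (induction m)
  case 0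
  show ?case by (rule eq_matI) (auto simp: mat_adjoint_def mat_of_rows_index)
next
  case (Suc m)
  then show ?case using kron_mat_adjoint[OF A kron_power_carrier[OF A, of m]] by simp
qed

lemma kron_power_mult:
  assumes A: "A \<in> carrier_mat n n" and B: "B \<in> carrier_mat n n"
  shows "kron_power A m * kron_power B m = kron_power (A * B) m"
proof (induction m)
  case (Suc m)
  then show ?case
    using kron_mat_mult[OF A kron_power_carrier[OF A, of m] B kron_power_carrier[OF B, of m]] by simp
qed simp

lemma kron_power_one: "kron_power (1\<^sub>m n) m = 1\<^sub>m (n ^ m)"
  by (induction m) (simp_all add: kron_mat_one)

lemma op_norm_le_kron_power:
  assumes A: "A \<in> carrier_mat n n" and b: "op_norm_le A C" and C: "0 \<le> C"
  shows "op_norm_le (kron_power A m) (C ^ m)"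
proof (induction m)
  case 0
  show ?case by (simp add: op_norm_le_def)
next
  case (Suc m)
  then show ?case
    using op_norm_le_kron_mat[OF A kron_power_carrier[OF A, of m] b _ C] C by simp
qed

text \<open>The list \<open>js\<close> consists of the digits of \<open>i\<close> in base \<open>n\<close>.\<close>

lemma col_kron_power:
  assumes U: "U \<in> carrier_mat n n" and "i < n ^ m"
  shows "\<exists>js. length js = m \<and> set js \<subseteq> {..<n} \<and> col (kron_power U m) i = kron_vecs (map (col U) js)"
  using assms(2)
proof (induction m arbitrary: i)
  case 0
  show ?case by (rule exI[of _ "[]"]) (use 0 in \<open>auto simp: col_def\<close>)
next
  case (Suc m)
  have i: "i < n * n ^ m" using Suc.prems by simp
  note ij = div_mod_less[OF i]
  obtain js where js: "length js = m" "set js \<subseteq> {..<n}"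
    "col (kron_power U m) (i mod n ^ m) = kron_vecs (map (col U) js)"
    using Suc.IH[OF ij(2)] by blast
  show ?case
    by (rule exI[of _ "(i div n ^ m) # js"])
      (use js ij col_kron_mat[OF U kron_power_carrier[OF U, of m] i] in auto)
qed

section \<open>Spans and the diagonal tensors\<close>

lemma span_vec_superset: "S \<subseteq> carrier_vec N \<Longrightarrow> s \<in> S \<Longrightarrow> s \<in> span_vec N S"
proof -
  interpret V: vec_space "TYPE(complex)" N .
  show "S \<subseteq> carrier_vec N \<Longrightarrow> s \<in> S \<Longrightarrow> s \<in> span_vec N S"
    using V.in_own_span by (auto simp: span_vec_def)
qed

lemma span_vec_zero: "0\<^sub>v N \<in> span_vec N S"
proof -
  interpret V: vec_space "TYPE(complex)" N .
  show ?thesis using V.span_zero by (simp add: span_vec_def)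
qed

lemma span_vec_smult:
  "S \<subseteq> carrier_vec N \<Longrightarrow> v \<in> span_vec N S \<Longrightarrow> c \<cdot>\<^sub>v v \<in> span_vec N S"
proof -
  interpret V: vec_space "TYPE(complex)" N .
  show "S \<subseteq> carrier_vec N \<Longrightarrow> v \<in> span_vec N S \<Longrightarrow> c \<cdot>\<^sub>v v \<in> span_vec N S"
    using V.smult_in_span by (simp add: span_vec_def)
qed

lemma span_vec_add:
  "S \<subseteq> carrier_vec N \<Longrightarrow> v \<in> span_vec N S \<Longrightarrow> w \<in> span_vec N S \<Longrightarrow> v + w \<in> span_vec N S"
proof -
  interpret V: vec_space "TYPE(complex)" N .
  show "S \<subseteq> carrier_vec N \<Longrightarrow> v \<in> span_vec N S \<Longrightarrow> w \<in> span_vec N S \<Longrightarrow> v + w \<in> span_vec N S"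
    using V.span_add1 by (simp add: span_vec_def)
qed

text \<open>Induction along a linear combination, adding one multiple of a generator at a time.\<close>

lemma span_vec_induct [consumes 2, case_names zero add]:
  assumes S: "S \<subseteq> carrier_vec N" and v: "v \<in> span_vec N S"
    and zero: "P (0\<^sub>v N)"
    and add: "\<And>c s w. \<lbrakk>s \<in> S; w \<in> carrier_vec N; P w\<rbrakk> \<Longrightarrow> P (c \<cdot>\<^sub>v s + w)"
  shows "P v"
proof -
  interpret V: vec_space "TYPE(complex)" N .
  obtain f F where F: "finite F" "F \<subseteq> S" and v: "v = V.lincomb f F"
    using V.in_spanE[of v S] v unfolding span_vec_def by blast
  have "P (V.lincomb f F)"
    using F
  proof (induction F rule: finite_induct)
    case empty
    then show ?case using zero by (simp add: V.lincomb_def)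
  next
    case (insert s F)
    have c: "insert s F \<subseteq> carrier_vec N" "F \<subseteq> carrier_vec N" "s \<in> carrier_vec N"
      using insert.prems S by auto
    have L: "V.lincomb f F \<in> carrier_vec N" "V.lincomb f (insert s F) \<in> carrier_vec N"
      using c by (auto intro!: V.lincomb_closed)
    have "V.lincomb f (insert s F) = f s \<cdot>\<^sub>v s + V.lincomb f F"
    proof (rule eq_vecI)
      fix i assume "i < dim_vec (f s \<cdot>\<^sub>v s + V.lincomb f F)"
      then have i: "i < N" using carrier_vecD[OF L(1)] by simp
      show "V.lincomb f (insert s F) $ i = (f s \<cdot>\<^sub>v s + V.lincomb f F) $ i"
        using insert.hyps i carrier_vecD[OF c(3)] carrier_vecD[OF L(1)]
        by (simp add: V.lincomb_index[OF i c(1)] V.lincomb_index[OF i c(2)] index_add_vec)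
    qed (simp only: carrier_vecD[OF L(1)] carrier_vecD[OF L(2)] index_add_vec)
    then show ?case using add[OF _ L(1), of s "f s"] insert by auto
  qed
  then show ?thesis using v by simp
qed

text \<open>The columns are added one at a time, skipping those with coefficient zero.\<close>

lemma mult_mat_vec_in_span:
  assumes M: "M \<in> carrier_mat N p" and y: "y \<in> carrier_vec p" and S: "S \<subseteq> carrier_vec N"
    and cols: "\<And>i. \<lbrakk>i < p; y $ i \<noteq> 0\<rbrakk> \<Longrightarrow> col M i \<in> S"
  shows "M *\<^sub>v y \<in> span_vec N S"
proof -
  have "vec N (\<lambda>r. \<Sum>i<q. M $$ (r, i) * y $ i) \<in> span_vec N S" if "q \<le> p" for q
    using that
  proof (induction q)
    case 0
    have "vec N (\<lambda>r. \<Sum>i<0. M $$ (r, i) * y $ i) = 0\<^sub>v N" by (rule eq_vecI) auto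
    then show ?case using span_vec_zero by simp
  next
    case (Suc q)
    let ?v = "vec N (\<lambda>r. \<Sum>i<q. M $$ (r, i) * y $ i)"
    have IH: "?v \<in> span_vec N S" using Suc by simp
    show ?case
    proof (cases "y $ q = 0")
      case True
      then show ?thesis using IH by simp
    next
      case False
      have "vec N (\<lambda>r. \<Sum>i<Suc q. M $$ (r, i) * y $ i) = ?v + y $ q \<cdot>\<^sub>v col M q"
        by (rule eq_vecI) (use M Suc.prems in auto)
      then show ?thesis
        using span_vec_add[OF S IH span_vec_smult[OF S span_vec_superset[OF S cols]]] False Suc.prems
        by simp
    qed
  qed
  moreover have "M *\<^sub>v y = vec N (\<lambda>r. \<Sum>i<p. M $$ (r, i) * y $ i)"
    by (rule eq_vecI) (use M mult_mat_vec_index[OF M y] in auto)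
  ultimately show ?thesis by simp
qed

definition diagonal_embedding :: "nat \<Rightarrow> nat \<Rightarrow> complex mat" where
  "diagonal_embedding n m =
     Matrix.mat (n ^ m) n (\<lambda>(i, j). kron_vecs (replicate m (unit_vec n j)) $ i)"

lemma diagonal_embedding_carrier [simp]: "diagonal_embedding n m \<in> carrier_mat (n ^ m) n"
  by (simp add: diagonal_embedding_def)

lemma kron_vecs_replicate_carrier:
  "x \<in> carrier_vec n \<Longrightarrow> kron_vecs (replicate m x) \<in> carrier_vec (n ^ m)"
  by (induction m) auto

lemma diagonal_embedding_mult_carrier [simp]:
  "x \<in> carrier_vec n \<Longrightarrow> diagonal_embedding n m *\<^sub>v x \<in> carrier_vec (n ^ m)"
  by (rule mult_mat_vec_carrier[OF diagonal_embedding_carrier])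

lemma col_diagonal_embedding:
  "j < n \<Longrightarrow> col (diagonal_embedding n m) j = kron_vecs (replicate m (unit_vec n j))"
  by (rule eq_vecI)
    (use kron_vecs_replicate_carrier[of "unit_vec n j" n m] in \<open>auto simp: diagonal_embedding_def\<close>)

lemma diagonal_tensor_span_iff:
  "v \<in> diagonal_tensor_span n m \<longleftrightarrow> (\<exists>x \<in> carrier_vec n. v = diagonal_embedding n m *\<^sub>v x)"
proof
  let ?G = "diagonal_embedding n m"
  let ?S = "{kron_vecs (replicate m (unit_vec n j)) | j. j < n}"
  have S: "?S \<subseteq> carrier_vec (n ^ m)"
    using kron_vecs_replicate_carrier by auto
  note G = diagonal_embedding_carrier[of n m]
  {
    assume "v \<in> diagonal_tensor_span n m"
    then have "v \<in> span_vec (n ^ m) ?S" by (simp add: diagonal_tensor_span_def)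
    with S show "\<exists>x \<in> carrier_vec n. v = ?G *\<^sub>v x"
    proof (induction rule: span_vec_induct)
      case zero
      show ?case
        by (rule bexI[of _ "0\<^sub>v n"]) (simp_all add: mult_mat_zero_vec[OF G])
    next
      case (add c s w)
      then obtain j x where j: "j < n" "s = col ?G j" and x: "x \<in> carrier_vec n" "w = ?G *\<^sub>v x"
        by (auto simp: col_diagonal_embedding)
      have "?G *\<^sub>v unit_vec n j = col ?G j"
        by (rule mult_mat_unit_vec[OF G j(1)])
      then have "c \<cdot>\<^sub>v s + w = ?G *\<^sub>v (c \<cdot>\<^sub>v unit_vec n j + x)"
        using j x by (simp add: mult_add_distrib_mat_vec[OF G] mult_mat_vec[OF G])
      then show ?case using x by (intro bexI[of _ "c \<cdot>\<^sub>v unit_vec n j + x"]) auto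
    qed
  }
  {
    assume "\<exists>x \<in> carrier_vec n. v = ?G *\<^sub>v x"
    then show "v \<in> diagonal_tensor_span n m"
      unfolding diagonal_tensor_span_def
      using mult_mat_vec_in_span[OF G _ S] col_diagonal_embedding by blast
  }
qed

lemma cinner_mult_mat_columns:
  fixes K G :: "complex mat"
  assumes K: "K \<in> carrier_mat N N" and G: "G \<in> carrier_mat N n" and i: "i < n" and j: "j < n"
  shows "(mat_adjoint G * K * G) $$ (i, j) = (K *\<^sub>v col G j) \<bullet>c col G i"
proof -
  have c: "col G i \<in> carrier_vec N" "K *\<^sub>v col G j \<in> carrier_vec N" "mat_adjoint G \<in> carrier_mat n N"
    using K G i j by auto
  have r: "row (mat_adjoint G) i = conjugate (col G i)"
    by (rule eq_vecI) (use G i in \<open>auto simp: adjoint_index[OF G] mat_adjoint_def\<close>)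
  have "mat_adjoint G * K * G = mat_adjoint G * (K * G)"
    by (rule assoc_mult_mat[OF c(3) K G])
  then have "(mat_adjoint G * K * G) $$ (i, j) = row (mat_adjoint G) i \<bullet> col (K * G) j"
    using carrier_matD(1)[OF c(3)] G i j by (subst index_mult_mat(1)[symmetric]) auto
  also have "col (K * G) j = K *\<^sub>v col G j" by (rule eq_vecI) (use K G j in auto)
  finally show ?thesis unfolding r using c by (simp add: comm_scalar_prod[of _ N])
qed

text \<open>The entry \<open>(i, j)\<close> of the compression is the inner product of \<open>A e\<^sub>j \<otimes> \<dots> \<otimes> A e\<^sub>j\<close> with
  \<open>e\<^sub>i \<otimes> \<dots> \<otimes> e\<^sub>i\<close>, which factors into the \<open>m\<close>-th power of the entry of \<open>A\<close>.\<close>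

lemma schur_power_compression:
  assumes A: "A \<in> carrier_mat n n"
  shows "mat_adjoint (diagonal_embedding n m) * kron_power A m * diagonal_embedding n m
    = schur_power A m" (is "?L = _")
proof (rule eq_matI)
  let ?G = "diagonal_embedding n m"
  fix i j assume "i < dim_row (schur_power A m)" "j < dim_col (schur_power A m)"
  then have i: "i < n" and j: "j < n" using A by (auto simp: schur_power_def)
  let ?e = "unit_vec n :: nat \<Rightarrow> complex vec"
  have "?L $$ (i, j) = (kron_power A m *\<^sub>v kron_vecs (replicate m (?e j))) \<bullet>c kron_vecs (replicate m (?e i))"
    using cinner_mult_mat_columns[OF kron_power_carrier[OF A] diagonal_embedding_carrier i j] i j
    by (simp add: col_diagonal_embedding)
  also have "kron_power A m *\<^sub>v kron_vecs (replicate m (?e j)) = kron_vecs (replicate m (A *\<^sub>v ?e j))"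
    using kron_power_mult_kron_vecs[OF A, of "replicate m (?e j)"]
    by (simp add: map_replicate set_replicate_conv_if)
  also have "\<dots> \<bullet>c kron_vecs (replicate m (?e i)) = ((A *\<^sub>v ?e j) \<bullet>c ?e i) ^ m"
    using A by (subst cinner_kron_vecs[where n=n])
      (auto simp: zip_replicate prod_list_replicate)
  also have "A *\<^sub>v ?e j = col A j" by (rule mult_mat_unit_vec[OF A j])
  also have "col A j \<bullet>c ?e i = A $$ (i, j)"
  proof -
    have "col A j \<bullet>c ?e i = (\<Sum>l<n. if l = i then A $$ (l, j) else 0)"
      unfolding cinner_sum[OF unit_vec_carrier]
      by (rule sum.cong) (use A i j in auto)
    then show ?thesis using i by simp
  qed
  finally show "?L $$ (i, j) = schur_power A m $$ (i, j)"
    using A i j by (simp add: schur_power_def)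
qed (use A in \<open>auto simp: schur_power_def mat_adjoint_def diagonal_embedding_def\<close>)

lemma schur_power_carrier [simp]: "A \<in> carrier_mat n n \<Longrightarrow> schur_power A m \<in> carrier_mat n n"
  by (simp add: schur_power_def)

lemma cinner_schur_power:
  assumes A: "A \<in> carrier_mat n n" and x: "x \<in> carrier_vec n" and y: "y \<in> carrier_vec n"
  shows "(schur_power A m *\<^sub>v x) \<bullet>c y
    = (kron_power A m *\<^sub>v (diagonal_embedding n m *\<^sub>v x)) \<bullet>c (diagonal_embedding n m *\<^sub>v y)"
proof -
  let ?G = "diagonal_embedding n m" and ?K = "kron_power A m"
  have G: "?G \<in> carrier_mat (n ^ m) n" and K: "?K \<in> carrier_mat (n ^ m) (n ^ m)"
    and G': "mat_adjoint ?G \<in> carrier_mat n (n ^ m)"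
    using A by simp_all
  have v: "?K *\<^sub>v (?G *\<^sub>v x) \<in> carrier_vec (n ^ m)" using K x by simp
  have "schur_power A m *\<^sub>v x = mat_adjoint ?G *\<^sub>v (?K *\<^sub>v (?G *\<^sub>v x))"
    unfolding schur_power_compression[OF A, symmetric]
    using assoc_mult_mat_vec[OF mult_carrier_mat[OF G' K] G x]
      assoc_mult_mat_vec[OF G' K diagonal_embedding_mult_carrier[OF x]] by simp
  then have "(schur_power A m *\<^sub>v x) \<bullet>c y = cnj (y \<bullet>c (mat_adjoint ?G *\<^sub>v (?K *\<^sub>v (?G *\<^sub>v x))))"
    using cinner_commute[of y n "mat_adjoint ?G *\<^sub>v (?K *\<^sub>v (?G *\<^sub>v x))"] y G' v by simp
  also have "\<dots> = cnj ((?G *\<^sub>v y) \<bullet>c (?K *\<^sub>v (?G *\<^sub>v x)))"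
    using cinner_adjoint[OF G y v] by simp
  also have "\<dots> = (?K *\<^sub>v (?G *\<^sub>v x)) \<bullet>c (?G *\<^sub>v y)"
    using cinner_commute[of "?G *\<^sub>v y" "n ^ m" "?K *\<^sub>v (?G *\<^sub>v x)"] v y by simp
  finally show ?thesis .
qed

text \<open>The isometry property is \<open>cinner_schur_power\<close> for the identity matrix, which equals its own Schur
  power and has an identity matrix as its Kronecker power. For \<open>m = 0\<close> its Schur power would be the all-ones matrix.\<close>

lemma cinner_diagonal_embedding:
  assumes m: "m \<ge> 1" and x: "x \<in> carrier_vec n" and y: "y \<in> carrier_vec n"
  shows "(diagonal_embedding n m *\<^sub>v x) \<bullet>c (diagonal_embedding n m *\<^sub>v y) = x \<bullet>c y"
proof -
  have "schur_power (1\<^sub>m n) m = 1\<^sub>m n"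
    by (rule eq_matI) (use m in \<open>auto simp: schur_power_def\<close>)
  then show ?thesis
    using cinner_schur_power[OF one_carrier_mat x y, of m] x y by (simp add: kron_power_one)
qed

lemma euclid_norm_diagonal_embedding:
  assumes "m \<ge> 1" "x \<in> carrier_vec n"
  shows "euclid_norm (diagonal_embedding n m *\<^sub>v x) = euclid_norm x"
proof -
  have "(euclid_norm (diagonal_embedding n m *\<^sub>v x))\<^sup>2 = (euclid_norm x)\<^sup>2"
    using cinner_diagonal_embedding[OF assms(1,2,2)] by (simp only: cinner_self of_real_eq_iff)
  then show ?thesis by (rule power2_eq_imp_eq) simp_all
qed

lemma diagonal_embedding_eq_0_iff:
  assumes "m \<ge> 1" "x \<in> carrier_vec n"
  shows "diagonal_embedding n m *\<^sub>v x = 0\<^sub>v (n ^ m) \<longleftrightarrow> x = 0\<^sub>v n"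
  using euclid_norm_diagonal_embedding[OF assms] assms(2)
    euclid_norm_eq_0_iff[of x n] euclid_norm_eq_0_iff[of "diagonal_embedding n m *\<^sub>v x" "n ^ m"]
  by simp

text \<open>The quadratic form of the Schur power at \<open>x\<close> is that of the Kronecker power at the tensor
  \<open>diagonal_embedding n m *\<^sub>v x\<close> of the same norm, and the latter is bounded by \<open>C ^ m\<close>. Attaining this
  bound is the equality case of Cauchy--Schwarz.\<close>

lemma numerical_radius_schur_power_eq_iff:
  assumes A: "A \<in> carrier_mat n n" and n: "n \<ge> 1" and m: "m \<ge> 1"
    and b: "op_norm_le A C" and C: "C \<ge> 0"
  shows "numerical_radius (schur_power A m) = C ^ m \<longleftrightarrow>
    (\<exists>v \<in> diagonal_tensor_span n m. \<exists>c. eigenvector (kron_power A m) v c \<and> cmod c = C ^ m)"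
proof
  let ?G = "diagonal_embedding n m" and ?K = "kron_power A m" and ?S = "schur_power A m"
  have K: "?K \<in> carrier_mat (n ^ m) (n ^ m)" and S: "?S \<in> carrier_mat n n" using A by simp_all
  have bK: "op_norm_le ?K (C ^ m)" by (rule op_norm_le_kron_power[OF A b C])
  obtain x where x: "x \<in> carrier_vec n" "euclid_norm x = 1"
    and e: "cmod ((?S *\<^sub>v x) \<bullet>c x) = numerical_radius ?S"
    using numerical_radius_max_vector[OF S n] by blast
  let ?v = "?G *\<^sub>v x"
  have v: "?v \<in> carrier_vec (n ^ m)" "euclid_norm ?v = 1"
    using x euclid_norm_diagonal_embedding[OF m x(1)] by auto
  have e': "cmod ((?K *\<^sub>v ?v) \<bullet>c ?v) = numerical_radius ?S"
    using e cinner_schur_power[OF A x(1) x(1)] by simp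
  {
    assume w: "numerical_radius ?S = C ^ m"
    have "?K *\<^sub>v ?v = ((?K *\<^sub>v ?v) \<bullet>c ?v) \<cdot>\<^sub>v ?v"
      by (rule op_norm_le_attained_eigenvector[OF K bK v]) (use e' w in simp)
    moreover have "?v \<noteq> 0\<^sub>v (n ^ m)" using v euclid_norm_eq_0_iff[OF v(1)] by auto
    ultimately have "eigenvector ?K ?v ((?K *\<^sub>v ?v) \<bullet>c ?v)"
      using K v by (simp add: eigenvector_def)
    then show "\<exists>v \<in> diagonal_tensor_span n m. \<exists>c. eigenvector ?K v c \<and> cmod c = C ^ m"
      using e' w x(1) diagonal_tensor_span_iff by metis
  }
  {
    assume "\<exists>v \<in> diagonal_tensor_span n m. \<exists>c. eigenvector ?K v c \<and> cmod c = C ^ m"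
    then obtain v c where "v \<in> diagonal_tensor_span n m" and ev: "eigenvector ?K v c"
      and c: "cmod c = C ^ m"
      by auto
    then obtain y where y: "y \<in> carrier_vec n" and vy: "v = ?G *\<^sub>v y"
      using diagonal_tensor_span_iff by auto
    note ev = ev[unfolded vy]
    have Gy: "?G *\<^sub>v y \<in> carrier_vec (n ^ m)" using y by simp
    have y0: "y \<noteq> 0\<^sub>v n" using ev K diagonal_embedding_eq_0_iff[OF m y] by (auto simp: eigenvector_def)
    have pos: "(euclid_norm y)\<^sup>2 > 0" using y0 euclid_norm_eq_0_iff[OF y] by simp
    have "(?S *\<^sub>v y) \<bullet>c y = (c \<cdot>\<^sub>v (?G *\<^sub>v y)) \<bullet>c (?G *\<^sub>v y)"
      using cinner_schur_power[OF A y y] ev by (simp add: eigenvector_def)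
    also have "\<dots> = c * (y \<bullet>c y)"
      unfolding cinner_smult_left[OF Gy Gy] cinner_diagonal_embedding[OF m y y] ..
    finally have "cmod ((?S *\<^sub>v y) \<bullet>c y) = C ^ m * (euclid_norm y)\<^sup>2"
      by (simp add: cinner_self norm_mult c norm_power)
    then have "C ^ m * (euclid_norm y)\<^sup>2 \<le> numerical_radius ?S * (euclid_norm y)\<^sup>2"
      using numerical_radius_quadratic_form[OF S n y] by simp
    then have "C ^ m \<le> numerical_radius ?S" using pos by simp
    moreover have "numerical_radius ?S \<le> C ^ m"
      using Cauchy_Schwarz_cinner[of "?K *\<^sub>v ?v" "n ^ m" ?v] op_norm_leD[OF bK K v(1)] K v e' by simp
    ultimately show "numerical_radius ?S = C ^ m" by simp
  }
qed

section \<open>Lowering the exponent by contraction\<close>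

text \<open>Over the complex numbers the principal submatrix with index set \<open>S\<close> has an eigenvector; it is
  extended by zero. The eigenvalue equation is then claimed at the coordinates in \<open>S\<close> only.\<close>

lemma principal_submatrix_eigenvector:
  fixes M :: "complex mat"
  assumes M: "M \<in> carrier_mat n n" and S: "S \<subseteq> {..<n}" "S \<noteq> {}"
  shows "\<exists>y \<in> carrier_vec n. y \<noteq> 0\<^sub>v n \<and> (\<forall>i<n. i \<notin> S \<longrightarrow> y $ i = 0) \<and>
    (\<exists>\<mu>. \<forall>i\<in>S. (M *\<^sub>v y) $ i = \<mu> * y $ i)"
proof -
  have fin: "finite S" using S(1) finite_subset by blast
  define s where "s = card S"
  obtain h where h: "bij_betw h {0..<s} S"
    using ex_bij_betw_nat_finite[OF fin] unfolding s_def by blast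
  have hS: "h p \<in> S" if "p < s" for p using bij_betwE[OF h] that by auto
  have s: "s > 0" using fin S(2) by (simp add: s_def card_gt_0_iff)
  define M' where "M' = Matrix.mat s s (\<lambda>(p, q). M $$ (h p, h q))"
  have M': "M' \<in> carrier_mat s s" by (simp add: M'_def)
  obtain \<mu> where "eigenvalue M' \<mu>"
    using spectrum_non_empty[OF M' s] by (auto simp: spectrum_def)
  then obtain u where u: "u \<in> carrier_vec s" "u \<noteq> 0\<^sub>v s" "M' *\<^sub>v u = \<mu> \<cdot>\<^sub>v u"
    using M' by (auto simp: eigenvalue_def eigenvector_def)
  define g where "g = the_inv_into {0..<s} h"
  have gh: "g (h p) = p" if "p < s" for p
    unfolding g_def by (rule the_inv_into_f_f) (use h that in \<open>auto simp: bij_betw_def\<close>)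
  define y where "y = vec n (\<lambda>i. if i \<in> S then u $ (g i) else 0)"
  have y: "y \<in> carrier_vec n" by (simp add: y_def)
  have yh: "y $ (h p) = u $ p" if "p < s" for p
    using hS[OF that] S(1) gh[OF that] by (auto simp: y_def)
  have "y \<noteq> 0\<^sub>v n"
  proof
    assume "y = 0\<^sub>v n"
    then have "u $ p = 0" if "p < s" for p using yh[OF that] hS[OF that] S(1) by auto
    then have "u = 0\<^sub>v s" using u(1) by (intro eq_vecI) auto
    then show False using u(2) by simp
  qed
  moreover have "(M *\<^sub>v y) $ i = \<mu> * y $ i" if i: "i \<in> S" for i
  proof -
    obtain p where p: "p < s" "i = h p" using h i by (auto simp: bij_betw_def)
    have iN: "i < n" using i S by auto
    have "(M *\<^sub>v y) $ i = (\<Sum>j<n. M $$ (i, j) * y $ j)" by (rule mult_mat_vec_index[OF M y iN])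
    also have "\<dots> = (\<Sum>j\<in>S. M $$ (i, j) * y $ j)"
      by (rule sum.mono_neutral_right) (use S(1) in \<open>auto simp: y_def\<close>)
    also have "\<dots> = (\<Sum>q\<in>{0..<s}. M $$ (i, h q) * y $ (h q))"
      by (rule sum.reindex_bij_betw[OF h, symmetric])
    also have "\<dots> = (\<Sum>q<s. M' $$ (p, q) * u $ q)"
      by (rule sum.cong) (use p yh in \<open>auto simp: M'_def\<close>)
    also have "\<dots> = (M' *\<^sub>v u) $ p" by (rule mult_mat_vec_index[OF M' u(1) p(1), symmetric])
    also have "\<dots> = \<mu> * y $ i" using u p yh by simp
    finally show ?thesis .
  qed
  ultimately show ?thesis using y by (intro bexI[of _ y]) (auto simp: y_def)
qed

text \<open>Contracting the first factor of \<open>\<Sum>\<^sub>i x\<^sub>i e\<^sub>i \<otimes> e\<^sub>i \<otimes> \<dots> \<otimes> e\<^sub>i\<close> with \<open>y\<close> multiplies the coefficients by the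
  conjugates of the entries of \<open>y\<close>, so the diagonal form is preserved.\<close>

lemma cinner_diagonal_embedding_Suc:
  assumes x: "x \<in> carrier_vec n" and y: "y \<in> carrier_vec n" and w: "w \<in> carrier_vec (n ^ m)"
  shows "(diagonal_embedding n (Suc m) *\<^sub>v x) \<bullet>c kron_vec y w
    = (diagonal_embedding n m *\<^sub>v vec n (\<lambda>i. x $ i * cnj (y $ i))) \<bullet>c w"
proof -
  have expand: "(diagonal_embedding n m *\<^sub>v x) \<bullet>c w
      = (\<Sum>j<n. x $ j * (kron_vecs (replicate m (unit_vec n j)) \<bullet>c w))"
    if x: "x \<in> carrier_vec n" and w: "w \<in> carrier_vec (n ^ m)" for x w m
  proof -
    let ?G = "diagonal_embedding n m"
    have "(?G *\<^sub>v x) \<bullet>c w = (\<Sum>r<n ^ m. \<Sum>j<n. ?G $$ (r, j) * x $ j * cnj (w $ r))"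
      unfolding cinner_sum[OF w]
      by (simp add: mult_mat_vec_index[OF diagonal_embedding_carrier x] sum_distrib_right)
    also have "\<dots> = (\<Sum>j<n. \<Sum>r<n ^ m. ?G $$ (r, j) * x $ j * cnj (w $ r))" by (rule sum.swap)
    also have "\<dots> = (\<Sum>j<n. x $ j * (kron_vecs (replicate m (unit_vec n j)) \<bullet>c w))"
      unfolding cinner_sum[OF w] sum_distrib_left
      by (intro sum.cong) (auto simp: diagonal_embedding_def)
    finally show ?thesis .
  qed
  have kw: "kron_vec y w \<in> carrier_vec (n ^ Suc m)" using kron_vec_carrier[OF y w] by simp
  have uy: "unit_vec n j \<bullet>c y = cnj (y $ j)" if "j < n" for j
  proof -
    have "unit_vec n j \<bullet>c y = (\<Sum>l<n. if l = j then cnj (y $ l) else 0)"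
      unfolding cinner_sum[OF y] by (rule sum.cong) (use that in auto)
    then show ?thesis using that by simp
  qed
  show ?thesis
    unfolding expand[OF x kw] expand[OF vec_carrier w]
  proof (rule sum.cong[OF refl])
    fix j assume "j \<in> {..<n}"
    then have j: "j < n" by simp
    show "x $ j * (kron_vecs (replicate (Suc m) (unit_vec n j)) \<bullet>c kron_vec y w)
      = vec n (\<lambda>i. x $ i * cnj (y $ i)) $ j * (kron_vecs (replicate m (unit_vec n j)) \<bullet>c w)"
      using j uy[OF j] cinner_kron_vec[OF unit_vec_carrier[of n j]
          kron_vecs_replicate_carrier[OF unit_vec_carrier[of n j]] y w]
      by simp
  qed
qed

text \<open>Let \<open>v = \<Sum>\<^sub>i x\<^sub>i e\<^sub>i \<otimes> \<dots> \<otimes> e\<^sub>i\<close> be the given eigenvector, \<open>s y\<close> its contraction with \<open>y\<close> in the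
  first factor, and \<open>K\<close> the \<open>m\<close>-th Kronecker power. Contracting the eigenvalue equation of \<open>v\<close> gives
  \<open>K (s (A\<^sup>* y)) = c s y\<close> for every \<open>y\<close>. The contraction sees only the coordinates where \<open>x\<close> is
  nonzero, so it suffices that \<open>y\<close> is an eigenvector of \<open>A\<^sup>*\<close> compressed to these coordinates, say
  with eigenvalue \<open>\<mu>\<close>; then \<open>cnj \<mu> K (s y) = c s y\<close>. Comparing norms gives \<open>\<bar>\<mu>\<bar> \<ge> C\<close>, and
  \<open>\<bar>\<mu>\<bar> \<le> C\<close> holds for every compression of \<open>A\<^sup>*\<close>. So \<open>s y\<close> has the eigenvalue \<open>c / cnj \<mu>\<close>, of
  modulus \<open>C ^ m\<close>.\<close>

lemma diagonal_eigenvector_descent: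
  assumes A: "A \<in> carrier_mat n n" and b: "op_norm_le A C" and C: "C > 0" and m: "m \<ge> 1"
    and ex: "\<exists>v \<in> diagonal_tensor_span n (Suc m).
      \<exists>c. eigenvector (kron_power A (Suc m)) v c \<and> cmod c = C ^ Suc m"
  shows "\<exists>v \<in> diagonal_tensor_span n m. \<exists>c. eigenvector (kron_power A m) v c \<and> cmod c = C ^ m"
proof -
  let ?G = "diagonal_embedding n" and ?K = "kron_power A m"
  have K: "?K \<in> carrier_mat (n ^ m) (n ^ m)" using A by simp
  have A': "mat_adjoint A \<in> carrier_mat n n" and K': "mat_adjoint ?K \<in> carrier_mat (n ^ m) (n ^ m)"
    using A K by (simp_all only: adjoint_carrier)
  obtain v c where "v \<in> diagonal_tensor_span n (Suc m)"
    and ev: "eigenvector (kron_power A (Suc m)) v c" and c: "cmod c = C ^ Suc m"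
    using ex by auto
  then obtain x where x: "x \<in> carrier_vec n" and v: "v = ?G (Suc m) *\<^sub>v x"
    using diagonal_tensor_span_iff by auto
  have vc: "v \<in> carrier_vec (n * n ^ m)" using x diagonal_embedding_mult_carrier[of x n "Suc m"] v by simp
  have KS: "kron_mat A ?K \<in> carrier_mat (n * n ^ m) (n * n ^ m)" using A K by simp
  have Kv: "kron_mat A ?K *\<^sub>v v = c \<cdot>\<^sub>v v" using ev by (simp add: eigenvector_def)
  have x0: "x \<noteq> 0\<^sub>v n"
    using ev KS diagonal_embedding_eq_0_iff[OF _ x, of "Suc m"] v by (auto simp: eigenvector_def)
  define S where "S = {i. i < n \<and> x $ i \<noteq> 0}"
  have S: "S \<subseteq> {..<n}" "S \<noteq> {}"
    using x x0 by (auto simp: S_def intro!: eq_vecI)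
  obtain y \<mu> where y: "y \<in> carrier_vec n" "y \<noteq> 0\<^sub>v n"
    and supp: "\<And>i. \<lbrakk>i < n; i \<notin> S\<rbrakk> \<Longrightarrow> y $ i = 0"
    and \<mu>: "\<And>i. i \<in> S \<Longrightarrow> (mat_adjoint A *\<^sub>v y) $ i = \<mu> * y $ i"
    using principal_submatrix_eigenvector[OF A' S] by blast
  define z where "z = vec n (\<lambda>i. x $ i * cnj (y $ i))"
  have z: "z \<in> carrier_vec n" by (simp add: z_def)
  have z0: "z \<noteq> 0\<^sub>v n"
  proof
    assume "z = 0\<^sub>v n"
    then have "z $ i = 0" if "i < n" for i using that by simp
    then have "x $ i * cnj (y $ i) = 0" if "i < n" for i using that by (simp add: z_def)
    then have "y $ i = 0" if "i < n" for i using that supp[of i] by (auto simp: S_def)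
    then show False using y by (auto intro!: eq_vecI)
  qed
  have A'y: "mat_adjoint A *\<^sub>v y \<in> carrier_vec n" by (rule mult_mat_vec_carrier[OF A' y(1)])
  \<comment> \<open>off \<open>S\<close> the factor \<open>x $ i\<close> vanishes, so the unknown coordinates of \<open>A\<^sup>* y\<close> do not matter\<close>
  have zA: "vec n (\<lambda>i. x $ i * cnj ((mat_adjoint A *\<^sub>v y) $ i)) = cnj \<mu> \<cdot>\<^sub>v z"
  proof (rule eq_vecI)
    fix i assume "i < dim_vec (cnj \<mu> \<cdot>\<^sub>v z)"
    then have i: "i < n" by (simp add: z_def)
    show "vec n (\<lambda>i. x $ i * cnj ((mat_adjoint A *\<^sub>v y) $ i)) $ i = (cnj \<mu> \<cdot>\<^sub>v z) $ i"
      using i \<mu>[of i] by (cases "i \<in> S") (auto simp: z_def S_def)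
  qed (simp add: z_def)
  let ?u = "?G m *\<^sub>v z"
  have u: "?u \<in> carrier_vec (n ^ m)" using z by simp
  have Ku: "?K *\<^sub>v ?u \<in> carrier_vec (n ^ m)" by (rule mult_mat_vec_carrier[OF K u])
  have key: "cnj \<mu> \<cdot>\<^sub>v (?K *\<^sub>v ?u) = c \<cdot>\<^sub>v ?u"
  proof (rule cinner_ext)
    fix w :: "complex vec" assume w: "w \<in> carrier_vec (n ^ m)"
    have K'w: "mat_adjoint ?K *\<^sub>v w \<in> carrier_vec (n ^ m)" by (rule mult_mat_vec_carrier[OF K' w])
    have yw: "kron_vec y w \<in> carrier_vec (n * n ^ m)" by (rule kron_vec_carrier[OF y(1) w])
    have "(c \<cdot>\<^sub>v ?u) \<bullet>c w = c * (v \<bullet>c kron_vec y w)"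
      unfolding v cinner_diagonal_embedding_Suc[OF x y(1) w] z_def[symmetric]
      by (rule cinner_smult_left[OF u w])
    also have "\<dots> = (kron_mat A ?K *\<^sub>v v) \<bullet>c kron_vec y w"
      unfolding Kv by (rule cinner_smult_left[OF vc yw, symmetric])
    also have "\<dots> = v \<bullet>c (mat_adjoint (kron_mat A ?K) *\<^sub>v kron_vec y w)"
      by (rule cinner_adjoint[OF KS vc yw])
    also have "mat_adjoint (kron_mat A ?K) *\<^sub>v kron_vec y w
        = kron_vec (mat_adjoint A *\<^sub>v y) (mat_adjoint ?K *\<^sub>v w)"
      unfolding kron_mat_adjoint[OF A K] by (rule kron_mat_mult_vec[OF A' K' y(1) w])
    also have "v \<bullet>c \<dots> = (?G m *\<^sub>v (cnj \<mu> \<cdot>\<^sub>v z)) \<bullet>c (mat_adjoint ?K *\<^sub>v w)"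
      unfolding v cinner_diagonal_embedding_Suc[OF x A'y K'w] zA ..
    also have "\<dots> = cnj \<mu> * (?u \<bullet>c (mat_adjoint ?K *\<^sub>v w))"
      unfolding mult_mat_vec[OF diagonal_embedding_carrier z] by (rule cinner_smult_left[OF u K'w])
    also have "?u \<bullet>c (mat_adjoint ?K *\<^sub>v w) = (?K *\<^sub>v ?u) \<bullet>c w"
      by (rule cinner_adjoint[OF K u w, symmetric])
    also have "cnj \<mu> * \<dots> = (cnj \<mu> \<cdot>\<^sub>v (?K *\<^sub>v ?u)) \<bullet>c w"
      by (rule cinner_smult_left[OF Ku w, symmetric])
    finally show "(cnj \<mu> \<cdot>\<^sub>v (?K *\<^sub>v ?u)) \<bullet>c w = (c \<cdot>\<^sub>v ?u) \<bullet>c w" by simp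
  qed (use Ku u in auto)
  have uz: "euclid_norm ?u = euclid_norm z" by (rule euclid_norm_diagonal_embedding[OF m z])
  have zpos: "euclid_norm z > 0" by (rule euclid_norm_pos[OF z z0])
  have "C ^ Suc m * euclid_norm z = euclid_norm (cnj \<mu> \<cdot>\<^sub>v (?K *\<^sub>v ?u))"
    unfolding key euclid_norm_smult uz c ..
  also have "\<dots> = cmod \<mu> * euclid_norm (?K *\<^sub>v ?u)"
    unfolding euclid_norm_smult by simp
  also have "\<dots> \<le> cmod \<mu> * (C ^ m * euclid_norm z)"
    using op_norm_leD[OF op_norm_le_kron_power[OF A b] K u] C uz
    by (intro mult_left_mono) auto
  finally have "C * (C ^ m * euclid_norm z) \<le> cmod \<mu> * (C ^ m * euclid_norm z)" by (simp add: mult_ac)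
  then have lower: "C \<le> cmod \<mu>" using C zpos by (simp add: mult_le_cancel_right)
  have ypos: "euclid_norm y > 0" by (rule euclid_norm_pos[OF y])
  have Ay: "A *\<^sub>v y \<in> carrier_vec n" by (rule mult_mat_vec_carrier[OF A y(1)])
  have "(mat_adjoint A *\<^sub>v y) \<bullet>c y = \<mu> * (y \<bullet>c y)"
    unfolding cinner_sum[OF y(1)] sum_distrib_left
  proof (rule sum.cong[OF refl])
    fix i assume "i \<in> {..<n}"
    then show "(mat_adjoint A *\<^sub>v y) $ i * cnj (y $ i) = \<mu> * (y $ i * cnj (y $ i))"
      using \<mu>[of i] supp[of i] by (cases "i \<in> S") auto
  qed
  then have "cmod \<mu> * (euclid_norm y)\<^sup>2 = cmod ((mat_adjoint A *\<^sub>v y) \<bullet>c y)"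
    by (simp only: cinner_self norm_mult norm_of_real) simp
  also have "\<dots> = cmod ((A *\<^sub>v y) \<bullet>c y)"
    using cinner_adjoint[OF A y(1) y(1)] cinner_commute[OF A'y y(1)] by simp
  also have "\<dots> \<le> (C * euclid_norm y) * euclid_norm y"
    using Cauchy_Schwarz_cinner[OF Ay y(1)] op_norm_leD[OF b A y(1)]
    by (meson order_trans mult_right_mono euclid_norm_nonneg)
  finally have "cmod \<mu> * (euclid_norm y)\<^sup>2 \<le> C * (euclid_norm y)\<^sup>2"
    by (simp add: power2_eq_square mult_ac)
  then have \<mu>C: "cmod \<mu> = C" using lower ypos by simp
  then have \<mu>0: "cnj \<mu> \<noteq> 0" using C by auto
  have "?K *\<^sub>v ?u = (1 / cnj \<mu>) \<cdot>\<^sub>v (cnj \<mu> \<cdot>\<^sub>v (?K *\<^sub>v ?u))"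
    using \<mu>0 by (simp add: smult_smult_assoc)
  also have "\<dots> = (c / cnj \<mu>) \<cdot>\<^sub>v ?u"
    unfolding key by (simp add: smult_smult_assoc)
  finally have "?K *\<^sub>v ?u = (c / cnj \<mu>) \<cdot>\<^sub>v ?u" .
  moreover have "?u \<noteq> 0\<^sub>v (n ^ m)" using diagonal_embedding_eq_0_iff[OF m z] z0 by simp
  ultimately have "eigenvector ?K ?u (c / cnj \<mu>)"
    using K u by (simp add: eigenvector_def)
  moreover have "cmod (c / cnj \<mu>) = C ^ m"
    using c \<mu>C C by (simp add: norm_divide)
  moreover have "?u \<in> diagonal_tensor_span n m" using diagonal_tensor_span_iff z by auto
  ultimately show ?thesis by blast
qed

section \<open>Tensors of columns\<close>

lemma kron_power_mult_eigenvectors: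
  assumes A: "A \<in> carrier_mat n n"
    and ev: "\<And>j. j \<in> set js \<Longrightarrow> u j \<in> carrier_vec n \<and> A *\<^sub>v u j = a j \<cdot>\<^sub>v u j"
  shows "kron_power A (length js) *\<^sub>v kron_vecs (map u js)
    = (\<Prod>j\<leftarrow>js. a j) \<cdot>\<^sub>v kron_vecs (map u js)"
  using ev
proof (induction js)
  case (Cons j js)
  let ?x = "kron_vecs (map u js)"
  have x: "?x \<in> carrier_vec (n ^ length js)"
    using kron_vecs_carrier[of "map u js" n] Cons.prems by auto
  have uj: "u j \<in> carrier_vec n" "A *\<^sub>v u j = a j \<cdot>\<^sub>v u j" using Cons.prems by auto
  have IH: "kron_power A (length js) *\<^sub>v ?x = (\<Prod>j\<leftarrow>js. a j) \<cdot>\<^sub>v ?x"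
    using Cons by simp
  have "kron_power A (length (j # js)) *\<^sub>v kron_vecs (map u (j # js))
      = kron_vec (a j \<cdot>\<^sub>v u j) ((\<Prod>j\<leftarrow>js. a j) \<cdot>\<^sub>v ?x)"
    using kron_mat_mult_vec[OF A kron_power_carrier[OF A, of "length js"] uj(1) x] uj(2) IH by simp
  also have "\<dots> = (a j * (\<Prod>j\<leftarrow>js. a j)) \<cdot>\<^sub>v kron_vec (u j) ?x"
    by (rule eq_vecI) (auto simp: kron_vec_def div_mod_less mult_ac)
  finally show ?case by simp
qed simp

lemma column_tensor_carrier:
  assumes U: "U \<in> carrier_mat n n" and "set js \<subseteq> {..<n}" "length js = m"
  shows "kron_vecs (map (col U) js) \<in> carrier_vec (n ^ m)"
proof -
  have "set (map (col U) js) \<subseteq> carrier_vec n" using assms by auto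
  then show ?thesis using kron_vecs_carrier[of "map (col U) js" n] assms(3) by simp
qed

text \<open>Each generator \<open>s\<close> is an eigenvector of the adjoint of the Kronecker power, with an eigenvalue of
  modulus \<open>C ^ m\<close>. If \<open>c\<close> had a different modulus, \<open>v\<close> would be orthogonal to every generator and
  hence to itself.\<close>

lemma column_tensor_span_eigenvalue:
  assumes A: "A \<in> carrier_mat n n" and b: "op_norm_le A C" and C: "C \<ge> 0"
    and U: "U \<in> carrier_mat n n" and k: "k \<le> n"
    and ev: "\<And>j. j < k \<Longrightarrow> A *\<^sub>v col U j = a j \<cdot>\<^sub>v col U j"
    and a: "\<And>j. j < k \<Longrightarrow> cmod (a j) = C"
    and v: "v \<in> column_tensor_span n m k U" and vc: "eigenvector (kron_power A m) v c"
  shows "cmod c = C ^ m"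
proof (rule ccontr)
  assume neq: "cmod c \<noteq> C ^ m"
  let ?K = "kron_power A m" and ?N = "n ^ m"
  let ?S = "{kron_vecs (map (col U) js) | js. length js = m \<and> set js \<subseteq> {..<k}}"
  have K: "?K \<in> carrier_mat ?N ?N" using A by simp
  have bK: "op_norm_le ?K (C ^ m)" by (rule op_norm_le_kron_power[OF A b C])
  have v: "v \<in> carrier_vec ?N" "v \<noteq> 0\<^sub>v ?N" "?K *\<^sub>v v = c \<cdot>\<^sub>v v" "v \<in> span_vec ?N ?S"
    using v vc K by (simp_all add: eigenvector_def column_tensor_span_def)
  have S: "?S \<subseteq> carrier_vec ?N" using column_tensor_carrier[OF U] k by fastforce
  have orth: "s \<bullet>c v = 0" if s: "s \<in> ?S" for s
  proof -
    obtain js where js: "s = kron_vecs (map (col U) js)" "length js = m" "set js \<subseteq> {..<k}"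
      using s by blast
    have sc: "s \<in> carrier_vec ?N" using s S by blast
    define l where "l = (\<Prod>j\<leftarrow>js. a j)"
    have "?K *\<^sub>v s = l \<cdot>\<^sub>v s"
      unfolding l_def js(1) js(2)[symmetric]
      by (rule kron_power_mult_eigenvectors[OF A]) (use js U k ev in \<open>auto simp: subset_iff\<close>)
    moreover have l: "cmod l = C ^ m"
      using js(3) unfolding l_def js(2)[symmetric] by (induction js) (auto simp: norm_mult a)
    ultimately have K's: "mat_adjoint ?K *\<^sub>v s = cnj l \<cdot>\<^sub>v s"
      using op_norm_le_adjoint_eigenvector[OF K _ sc] bK by simp
    have "c * (v \<bullet>c s) = (?K *\<^sub>v v) \<bullet>c s" unfolding v(3) by (rule cinner_smult_left[OF v(1) sc, symmetric])
    also have "\<dots> = v \<bullet>c (mat_adjoint ?K *\<^sub>v s)" by (rule cinner_adjoint[OF K v(1) sc])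
    also have "\<dots> = l * (v \<bullet>c s)" unfolding K's using cinner_smult_right[OF v(1) sc] by simp
    finally have "v \<bullet>c s = 0" using l neq by auto
    then show "s \<bullet>c v = 0" using cinner_commute[OF v(1) sc] by simp
  qed
  have "v \<bullet>c v = 0"
  proof -
    have "w \<bullet>c v = 0" if "w \<in> span_vec ?N ?S" for w
      using S that
    proof (induction rule: span_vec_induct)
      case zero
      then show ?case using v(1) by simp
    next
      case (add d s w)
      have sc: "s \<in> carrier_vec ?N" using add(1) S by blast
      have "(d \<cdot>\<^sub>v s + w) \<bullet>c v = d * (s \<bullet>c v) + w \<bullet>c v"
        using cinner_add_left[OF smult_carrier_vec[THEN iffD2, OF sc] add(2) v(1), of d]
          cinner_smult_left[OF sc v(1)] by simp
      then show ?case using orth[OF add(1)] add(3) by simp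
    qed
    then show ?thesis using v(4) .
  qed
  then have "euclid_norm v = 0" by (simp add: cinner_self)
  then show False using euclid_norm_eq_0_iff[OF v(1)] v(2) by simp
qed

text \<open>The columns of the unitary matrix \<open>kron_power U m\<close> are the tensors of columns of \<open>U\<close>, so the
  coefficients of \<open>v\<close> in this orthonormal basis are its inner products with them.\<close>

lemma column_tensor_span_complete:
  assumes U: "unitary_mat n U" and k: "k \<le> n" and v: "v \<in> carrier_vec (n ^ m)"
    and orth: "\<And>js. \<lbrakk>length js = m; set js \<subseteq> {..<n}; \<not> set js \<subseteq> {..<k}\<rbrakk>
      \<Longrightarrow> v \<bullet>c kron_vecs (map (col U) js) = 0"
  shows "v \<in> column_tensor_span n m k U"
proof -
  let ?W = "kron_power U m" and ?N = "n ^ m"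
  have Uc: "U \<in> carrier_mat n n" and UU: "U * mat_adjoint U = 1\<^sub>m n"
    using U by (auto simp: unitary_mat_def)
  have W: "?W \<in> carrier_mat ?N ?N" using Uc by simp
  have W': "mat_adjoint ?W \<in> carrier_mat ?N ?N" by (rule adjoint_carrier[OF W])
  have WW: "?W * mat_adjoint ?W = 1\<^sub>m ?N"
    unfolding kron_power_adjoint[OF Uc] kron_power_mult[OF Uc adjoint_carrier[OF Uc]] UU
    by (rule kron_power_one)
  define y where "y = mat_adjoint ?W *\<^sub>v v"
  have y: "y \<in> carrier_vec ?N" unfolding y_def by (rule mult_mat_vec_carrier[OF W' v])
  have vy: "v = ?W *\<^sub>v y"
    unfolding y_def using assoc_mult_mat_vec[OF W W' v] WW v by simp
  have yi: "y $ i = v \<bullet>c col ?W i" if i: "i < ?N" for i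
  proof -
    have c: "col ?W i \<in> carrier_vec ?N" using W i by auto
    show ?thesis
      unfolding y_def mult_mat_vec_index[OF W' v i] cinner_sum[OF c]
      by (rule sum.cong) (use W i in \<open>auto simp: adjoint_index[OF W] mult.commute\<close>)
  qed
  show ?thesis
    unfolding column_tensor_span_def vy
  proof (rule mult_mat_vec_in_span[OF W y])
    show "{kron_vecs (map (col U) js) | js. length js = m \<and> set js \<subseteq> {..<k}} \<subseteq> carrier_vec ?N"
      using column_tensor_carrier[OF Uc] k by fastforce
    fix i assume i: "i < ?N" and ne: "y $ i \<noteq> 0"
    obtain js where js: "length js = m" "set js \<subseteq> {..<n}" "col ?W i = kron_vecs (map (col U) js)"
      using col_kron_power[OF Uc i] by blast
    have "set js \<subseteq> {..<k}" using orth[OF js(1,2)] ne yi[OF i] js(3) by auto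
    then show "col ?W i \<in> {kron_vecs (map (col U) js) | js. length js = m \<and> set js \<subseteq> {..<k}}"
      using js by blast
  qed
qed

text \<open>Bounds a product of norm ratios by the single ratio that tends to zero.\<close>

lemma prod_list_le_member:
  fixes f :: "'a \<Rightarrow> real"
  assumes "\<And>y. y \<in> set xs \<Longrightarrow> 0 \<le> f y \<and> f y \<le> 1" and "x \<in> set xs"
  shows "(\<Prod>y\<leftarrow>xs. f y) \<le> f x"
  using assms
proof (induction xs)
  case (Cons z xs)
  have P: "0 \<le> (\<Prod>y\<leftarrow>xs. f y) \<and> (\<Prod>y\<leftarrow>xs. f y) \<le> 1"
  proof -
    have "\<forall>y\<in>set xs. 0 \<le> f y \<and> f y \<le> 1" using Cons.prems(1) by simp
    then show ?thesis by (induction xs) (auto intro!: mult_nonneg_nonneg mult_le_one)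
  qed
  show ?case
  proof (cases "x = z")
    case True
    then show ?thesis using P Cons.prems(1)[of z] by (simp add: mult_left_le)
  next
    case False
    then have "(\<Prod>y\<leftarrow>xs. f y) \<le> f x" using Cons by auto
    then have "f z * (\<Prod>y\<leftarrow>xs. f y) \<le> 1 * f x"
      using Cons.prems(1)[of z] P by (intro mult_mono) auto
    then show ?thesis by simp
  qed
qed simp

text \<open>As \<open>v\<close> is also an eigenvector of the adjoint of the Kronecker power, applying \<open>A\<^sup>p\<close> to every factor of
  the tensor multiplies its inner product with \<open>v\<close> by \<open>c\<^sup>p\<close>, of modulus \<open>C ^ (m * p)\<close>. Meanwhile
  the norm of the tensor is at most \<open>C ^ (m * p)\<close> times the ratio \<open>\<parallel>A\<^sup>p u\<parallel> / C\<^sup>p\<close> of the decaying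
  factor. So the original inner product is bounded by a null sequence.\<close>

lemma decaying_factor_orthogonal:
  assumes A: "A \<in> carrier_mat n n" and b: "op_norm_le A C" and C: "C > 0"
    and us: "set us \<subseteq> carrier_vec n" "length us = m" "\<And>u. u \<in> set us \<Longrightarrow> euclid_norm u \<le> 1"
    and u: "u \<in> set us"
    and decay: "(\<lambda>p. euclid_norm (((\<lambda>x. A *\<^sub>v x) ^^ p) u) / C ^ p) \<longlonglongrightarrow> 0"
    and v: "v \<in> carrier_vec (n ^ m)" "kron_power A m *\<^sub>v v = c \<cdot>\<^sub>v v" and c: "cmod c = C ^ m"
  shows "v \<bullet>c kron_vecs us = 0"
proof -
  let ?K = "kron_power A m" and ?f = "\<lambda>x. A *\<^sub>v x"
  have K: "?K \<in> carrier_mat (n ^ m) (n ^ m)" using A by simp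
  have K'v: "mat_adjoint ?K *\<^sub>v v = cnj c \<cdot>\<^sub>v v"
    by (rule op_norm_le_adjoint_eigenvector[OF K _ v])
      (use op_norm_le_kron_power[OF A b, of m] C c in simp)
  have f: "(?f ^^ p) w \<in> carrier_vec n \<and> euclid_norm ((?f ^^ p) w) \<le> C ^ p * euclid_norm w"
    if w: "w \<in> carrier_vec n" for w p
  proof (induction p)
    case (Suc p)
    then have "euclid_norm (?f ((?f ^^ p) w)) \<le> C * (C ^ p * euclid_norm w)"
      using op_norm_leD[OF b A] C by (meson order_trans mult_left_mono less_imp_le)
    then show ?case using Suc A by (simp add: mult.assoc)
  qed (use w in simp)
  have fc: "set (map (?f ^^ p) us) \<subseteq> carrier_vec n" for p using f us(1) by auto
  have kc: "kron_vecs (map (?f ^^ p) us) \<in> carrier_vec (n ^ m)" for p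
    using kron_vecs_carrier[OF fc, of p] us(2) by simp
  have power: "kron_vecs (map (?f ^^ p) us) \<bullet>c v = c ^ p * (kron_vecs us \<bullet>c v)" for p
  proof (induction p)
    case (Suc p)
    let ?x = "kron_vecs (map (?f ^^ p) us)"
    have "kron_vecs (map (?f ^^ Suc p) us) = ?K *\<^sub>v ?x"
      using kron_power_mult_kron_vecs[OF A fc, of p] us(2) by (simp add: comp_def)
    then have "kron_vecs (map (?f ^^ Suc p) us) \<bullet>c v = ?x \<bullet>c (mat_adjoint ?K *\<^sub>v v)"
      using cinner_adjoint[OF K kc v(1)] by simp
    also have "\<dots> = c * (?x \<bullet>c v)"
      unfolding K'v using cinner_smult_right[OF kc v(1)] by simp
    finally show ?case unfolding Suc by (simp add: comp_def mult.assoc)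
  qed simp
  have bound: "cmod (kron_vecs us \<bullet>c v) \<le> euclid_norm ((?f ^^ p) u) / C ^ p * euclid_norm v" for p
  proof -
    let ?r = "\<lambda>w. euclid_norm ((?f ^^ p) w) / C ^ p"
    have "C ^ (m * p) * cmod (kron_vecs us \<bullet>c v) = cmod (kron_vecs (map (?f ^^ p) us) \<bullet>c v)"
      unfolding power by (simp add: norm_mult norm_power c power_mult)
    also have "\<dots> \<le> euclid_norm (kron_vecs (map (?f ^^ p) us)) * euclid_norm v"
      by (rule Cauchy_Schwarz_cinner[OF kc v(1)])
    also have "euclid_norm (kron_vecs (map (?f ^^ p) us)) = (\<Prod>w\<leftarrow>us. C ^ p * ?r w)"
      using C by (simp add: euclid_norm_kron_vecs comp_def)
    also have "\<dots> = C ^ (m * p) * (\<Prod>w\<leftarrow>us. ?r w)"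
      unfolding us(2)[symmetric] by (induction us) (simp_all add: power_add mult_ac)
    finally have "cmod (kron_vecs us \<bullet>c v) \<le> (\<Prod>w\<leftarrow>us. ?r w) * euclid_norm v"
      using C by (simp add: mult.assoc)
    also have "(\<Prod>w\<leftarrow>us. ?r w) \<le> ?r u"
    proof (rule prod_list_le_member[OF _ u])
      fix w assume w: "w \<in> set us"
      have "euclid_norm ((?f ^^ p) w) \<le> C ^ p * euclid_norm w" using f w us(1) by auto
      also have "\<dots> \<le> C ^ p" using us(3)[OF w] C by (simp add: mult_left_le)
      finally show "0 \<le> ?r w \<and> ?r w \<le> 1" using C by simp
    qed
    finally show ?thesis by (simp add: mult_right_mono)
  qed
  have "(\<lambda>p. euclid_norm ((?f ^^ p) u) / C ^ p * euclid_norm v) \<longlonglongrightarrow> 0"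
    using tendsto_mult_left_zero[OF decay] .
  then have "cmod (kron_vecs us \<bullet>c v) \<le> 0"
    by (rule LIMSEQ_le_const) (use bound in blast)
  then show ?thesis using cinner_commute[OF v(1), of "kron_vecs us"] kron_vecs_carrier[OF us(1)] us(2)
    by (metis complex_cnj_zero norm_le_zero_iff complex_cnj_cnj)
qed

text \<open>Scaling by a number \<open>R\<close> strictly between the spectral radius and \<open>C\<close> makes the spectral radius less
  than one, and then the powers are bounded; so the entries of \<open>B ^\<^sub>m p\<close> grow at most like \<open>R ^ p\<close>.\<close>

lemma spectral_radius_less_power_decay:
  fixes B :: "complex mat"
  assumes B: "B \<in> carrier_mat r r" and C: "C > 0"
    and ev: "\<And>\<mu>. eigenvalue B \<mu> \<Longrightarrow> cmod \<mu> < C"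
    and i: "i < r" and j: "j < r"
  shows "(\<lambda>p. cmod ((B ^\<^sub>m p) $$ (i, j)) / C ^ p) \<longlonglongrightarrow> 0"
proof -
  have r: "r > 0" using i by simp
  have "spectral_radius B \<in> cmod ` spectrum B" by (rule spectral_radius_mem_max(1)[OF B r])
  then have \<rho>: "spectral_radius B < C" "0 \<le> spectral_radius B"
    using ev by (auto simp: spectrum_def)
  define R where "R = (spectral_radius B + C) / 2"
  have R: "spectral_radius B < R" "R < C" "R > 0" using \<rho> C by (auto simp: R_def)
  define s where "s = complex_of_real (1 / R)"
  have s0: "s \<noteq> 0" using R by (simp add: s_def)
  let ?B = "s \<cdot>\<^sub>m B"
  have B': "?B \<in> carrier_mat r r" using B by simp
  have "spectral_radius ?B \<in> cmod ` spectrum ?B" by (rule spectral_radius_mem_max(1)[OF B' r])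
  then obtain l where l: "eigenvalue ?B l" "spectral_radius ?B = cmod l" by (auto simp: spectrum_def)
  then obtain x where x: "x \<in> carrier_vec r" "x \<noteq> 0\<^sub>v r" "?B *\<^sub>v x = l \<cdot>\<^sub>v x"
    using B by (auto simp: eigenvalue_def eigenvector_def)
  have "s \<cdot>\<^sub>v (B *\<^sub>v x) = l \<cdot>\<^sub>v x"
    unfolding x(3)[symmetric] by (rule eq_vecI) (use x(1) B in auto)
  then have "(1 / s) \<cdot>\<^sub>v (s \<cdot>\<^sub>v (B *\<^sub>v x)) = (1 / s) \<cdot>\<^sub>v (l \<cdot>\<^sub>v x)" by simp
  then have "B *\<^sub>v x = (l / s) \<cdot>\<^sub>v x"
    using s0 by (simp add: smult_smult_assoc)
  then have "eigenvalue B (l / s)" using x B by (auto simp: eigenvalue_def eigenvector_def)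
  then have "cmod (l / s) \<in> cmod ` spectrum B" by (simp add: spectrum_def)
  then have "cmod (l / s) \<le> spectral_radius B" by (rule spectral_radius_mem_max(2)[OF B r])
  then have "cmod l * R \<le> spectral_radius B" using R by (simp add: s_def norm_divide norm_mult)
  then have "cmod l * R < R" using R by linarith
  then have "spectral_radius ?B < 1" using R l by simp
  then obtain c where c: "\<And>p. norm_bound (?B ^\<^sub>m p) c"
    using spectral_radius_jnf_norm_bound_less_1_upper_triangular[OF B'] by blast
  have pow: "?B ^\<^sub>m p = s ^ p \<cdot>\<^sub>m (B ^\<^sub>m p)" for p
  proof (induction p)
    case 0
    show ?case using B by (auto intro!: eq_matI)
  next
    case (Suc p)
    have Bp: "B ^\<^sub>m p \<in> carrier_mat r r" using B by simp
    have "?B ^\<^sub>m Suc p = (s ^ p \<cdot>\<^sub>m (B ^\<^sub>m p)) * (s \<cdot>\<^sub>m B)" using Suc by simp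
    also have "\<dots> = s ^ p \<cdot>\<^sub>m (B ^\<^sub>m p * (s \<cdot>\<^sub>m B))"
      by (rule mult_smult_assoc_mat[OF Bp B'])
    also have "B ^\<^sub>m p * (s \<cdot>\<^sub>m B) = s \<cdot>\<^sub>m (B ^\<^sub>m p * B)"
      by (rule mult_smult_distrib[OF Bp B])
    also have "s ^ p \<cdot>\<^sub>m (s \<cdot>\<^sub>m (B ^\<^sub>m p * B)) = s ^ Suc p \<cdot>\<^sub>m (B ^\<^sub>m Suc p)"
      by (rule eq_matI) (use Bp B in auto)
    finally show ?case .
  qed
  have bound: "cmod ((B ^\<^sub>m p) $$ (i, j)) / C ^ p \<le> c * (R / C) ^ p" for p
  proof -
    have "cmod ((?B ^\<^sub>m p) $$ (i, j)) \<le> c"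
      using c[of p, unfolded norm_bound_def] carrier_matD[OF pow_carrier_mat[OF B'], of p] i j
      by (simp only:)
    then have "cmod ((B ^\<^sub>m p) $$ (i, j)) / R ^ p \<le> c"
      using B R i j unfolding pow by (simp add: s_def norm_mult norm_power norm_divide power_divide)
    then have "cmod ((B ^\<^sub>m p) $$ (i, j)) \<le> c * R ^ p" using R by (simp add: divide_le_eq)
    then show ?thesis using C by (simp add: power_divide divide_right_mono)
  qed
  have "(\<lambda>p. c * (R / C) ^ p) \<longlonglongrightarrow> 0"
    by (rule tendsto_mult_right_zero[OF LIMSEQ_realpow_zero]) (use R C in auto)
  then show ?thesis
    by (rule tendsto_sandwich[OF _ _ tendsto_const, rotated 2])
      (use bound C in \<open>auto intro!: always_eventually\<close>)
qed

section \<open>Jordan blocks and block diagonalization\<close>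

text \<open>The first two unit vectors of a block of size at least two, embedded at the position of the
  block.\<close>

lemma jordan_matrix_chain:
  fixes c :: complex
  assumes "(s, c) \<in> set blocks" "s \<ge> 2"
  shows "\<exists>x y. x \<in> carrier_vec (sum_list (map fst blocks)) \<and> y \<in> carrier_vec (sum_list (map fst blocks)) \<and>
    x \<noteq> 0\<^sub>v (sum_list (map fst blocks)) \<and>
    jordan_matrix blocks *\<^sub>v x = c \<cdot>\<^sub>v x \<and> jordan_matrix blocks *\<^sub>v y = c \<cdot>\<^sub>v y + x"
  using assms(1)
proof (induction blocks)
  case (Cons b blocks)
  obtain t d where b: "b = (t, d)" by fastforce
  let ?n = "sum_list (map fst blocks)" and ?B = "jordan_block t d" and ?J = "jordan_matrix blocks"
  have B: "?B \<in> carrier_mat t t" by simp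
  have J: "?J \<in> carrier_mat ?n ?n" by simp
  have JJ: "jordan_matrix (b # blocks) = four_block_mat ?B (0\<^sub>m t ?n) (0\<^sub>m ?n t) ?J"
    by (simp add: jordan_matrix_def b Let_def jordan_matrix_dim[unfolded jordan_matrix_def])
  have split: "jordan_matrix (b # blocks) *\<^sub>v (u @\<^sub>v w) = (?B *\<^sub>v u) @\<^sub>v (?J *\<^sub>v w)"
    if "u \<in> carrier_vec t" "w \<in> carrier_vec ?n" for u w
    unfolding JJ by (rule mult_mat_vec_split[OF B J that])
  have smult_app: "e \<cdot>\<^sub>v (u @\<^sub>v w) = (e \<cdot>\<^sub>v u) @\<^sub>v (e \<cdot>\<^sub>v w)" for e :: complex and u w
    by (rule eq_vecI) auto
  have add_app: "(u @\<^sub>v w) + (u' @\<^sub>v w') = (u + u') @\<^sub>v (w + w')"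
    if "u \<in> carrier_vec t" "w \<in> carrier_vec ?n" "u' \<in> carrier_vec t" "w' \<in> carrier_vec ?n"
    for u w u' w' :: "complex vec"
    by (rule eq_vecI) (use that in auto)
  have smult_0: "c \<cdot>\<^sub>v 0\<^sub>v N = 0\<^sub>v N" for N by (rule eq_vecI) auto
  show ?case
  proof (cases "(s, c) = b")
    case True
    then have t: "t \<ge> 2" "d = c" using assms(2) b by auto
    let ?x = "unit_vec t 0 :: complex vec" and ?y = "unit_vec t (Suc 0) :: complex vec"
    have Bx: "?B *\<^sub>v ?x = c \<cdot>\<^sub>v ?x"
      using t by (subst mult_mat_unit_vec[OF B]) (auto intro!: eq_vecI)
    have By: "?B *\<^sub>v ?y = c \<cdot>\<^sub>v ?y + ?x"
      using t by (subst mult_mat_unit_vec[OF B]) (auto intro!: eq_vecI)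
    have Jz: "?J *\<^sub>v 0\<^sub>v ?n = 0\<^sub>v ?n" by (rule mult_mat_zero_vec[OF J])
    show ?thesis
    proof (intro exI conjI)
      show "?x @\<^sub>v 0\<^sub>v ?n \<in> carrier_vec (sum_list (map fst (b # blocks)))"
        "?y @\<^sub>v 0\<^sub>v ?n \<in> carrier_vec (sum_list (map fst (b # blocks)))"
        by (simp_all add: b)
      have "(?x @\<^sub>v 0\<^sub>v ?n) $ 0 = 1" using t by simp
      moreover have "0\<^sub>v (sum_list (map fst (b # blocks))) $ 0 = (0 :: complex)"
        using t by (simp add: b)
      ultimately show "?x @\<^sub>v 0\<^sub>v ?n \<noteq> 0\<^sub>v (sum_list (map fst (b # blocks)))"
        by (metis zero_neq_one)
      show "jordan_matrix (b # blocks) *\<^sub>v (?x @\<^sub>v 0\<^sub>v ?n) = c \<cdot>\<^sub>v (?x @\<^sub>v 0\<^sub>v ?n)"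
        by (simp add: split Bx Jz smult_app smult_0)
      show "jordan_matrix (b # blocks) *\<^sub>v (?y @\<^sub>v 0\<^sub>v ?n)
          = c \<cdot>\<^sub>v (?y @\<^sub>v 0\<^sub>v ?n) + (?x @\<^sub>v 0\<^sub>v ?n)"
        by (simp add: split By Jz smult_app smult_0 add_app)
    qed
  next
    case False
    then obtain x y where xy: "x \<in> carrier_vec ?n" "y \<in> carrier_vec ?n" "x \<noteq> 0\<^sub>v ?n"
      "?J *\<^sub>v x = c \<cdot>\<^sub>v x" "?J *\<^sub>v y = c \<cdot>\<^sub>v y + x"
      using Cons by auto
    have Bz: "?B *\<^sub>v 0\<^sub>v t = 0\<^sub>v t" by (rule mult_mat_zero_vec[OF B])
    show ?thesis
    proof (intro exI conjI)
      show "0\<^sub>v t @\<^sub>v x \<in> carrier_vec (sum_list (map fst (b # blocks)))"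
        "0\<^sub>v t @\<^sub>v y \<in> carrier_vec (sum_list (map fst (b # blocks)))"
        using xy by (simp_all add: b)
      show "0\<^sub>v t @\<^sub>v x \<noteq> 0\<^sub>v (sum_list (map fst (b # blocks)))"
      proof
        assume z: "0\<^sub>v t @\<^sub>v x = 0\<^sub>v (sum_list (map fst (b # blocks)))"
        have "x $ i = 0" if "i < ?n" for i
          using arg_cong[OF z, of "\<lambda>v. v $ (t + i)"] that xy(1) by (simp add: b)
        then have "x = 0\<^sub>v ?n" using xy(1) by (intro eq_vecI) auto
        then show False using xy(3) by simp
      qed
      show "jordan_matrix (b # blocks) *\<^sub>v (0\<^sub>v t @\<^sub>v x) = c \<cdot>\<^sub>v (0\<^sub>v t @\<^sub>v x)"
        using xy by (simp add: split Bz smult_app smult_0)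
      show "jordan_matrix (b # blocks) *\<^sub>v (0\<^sub>v t @\<^sub>v y) = c \<cdot>\<^sub>v (0\<^sub>v t @\<^sub>v y) + (0\<^sub>v t @\<^sub>v x)"
        using xy by (simp add: split Bz smult_app smult_0 add_app)
    qed
  qed
qed simp

text \<open>A larger block would give \<open>u \<noteq> 0\<close> and \<open>w\<close> with \<open>A u = c u\<close> and \<open>A w = c w + u\<close>. Since \<open>u\<close> is also an
  eigenvector of the adjoint with eigenvalue \<open>cnj c\<close>, it is orthogonal to \<open>(A - c) w = u\<close>.\<close>

lemma extremal_jordan_blocks_trivial:
  assumes A: "A \<in> carrier_mat n n" and b: "op_norm_le A (cmod c)"
    and jnf: "jordan_nf A blocks" and sc: "(s, c) \<in> set blocks"
  shows "s = 1"
proof (rule ccontr)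
  assume "s \<noteq> 1"
  have nz: "0 \<notin> fst ` set blocks" and sim: "similar_mat A (jordan_matrix blocks)"
    using jnf by (auto simp: jordan_nf_def)
  have "s \<noteq> 0" using nz sc by force
  then have s: "s \<ge> 2" using \<open>s \<noteq> 1\<close> by simp
  let ?J = "jordan_matrix blocks"
  obtain P Q where "similar_mat_wit A ?J P Q" using sim by (auto simp: similar_mat_def)
  from similar_mat_witD2[OF A this]
  have PQ: "Q * P = 1\<^sub>m n" "A = P * ?J * Q" and J: "?J \<in> carrier_mat n n"
    and P: "P \<in> carrier_mat n n" and Q: "Q \<in> carrier_mat n n" by auto
  have N: "sum_list (map fst blocks) = n" using J by (metis carrier_matD(1) jordan_matrix_dim(1))
  obtain x y where xy: "x \<in> carrier_vec n" "y \<in> carrier_vec n" "x \<noteq> 0\<^sub>v n"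
    "?J *\<^sub>v x = c \<cdot>\<^sub>v x" "?J *\<^sub>v y = c \<cdot>\<^sub>v y + x"
    using jordan_matrix_chain[OF sc s] unfolding N by blast
  have QP: "Q *\<^sub>v (P *\<^sub>v w) = w" if "w \<in> carrier_vec n" for w
    using assoc_mult_mat_vec[OF Q P that] PQ(1) that by simp
  have AP: "A *\<^sub>v (P *\<^sub>v w) = P *\<^sub>v (?J *\<^sub>v w)" if w: "w \<in> carrier_vec n" for w
  proof -
    have "A *\<^sub>v (P *\<^sub>v w) = (P * ?J) *\<^sub>v (Q *\<^sub>v (P *\<^sub>v w))"
      unfolding PQ(2) by (rule assoc_mult_mat_vec[OF mult_carrier_mat[OF P J] Q mult_mat_vec_carrier[OF P w]])
    then show ?thesis using QP[OF w] assoc_mult_mat_vec[OF P J w] by simp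
  qed
  define u where "u = P *\<^sub>v x"
  define w where "w = P *\<^sub>v y"
  have u: "u \<in> carrier_vec n" and w: "w \<in> carrier_vec n"
    unfolding u_def w_def by (rule mult_mat_vec_carrier[OF P xy(1)], rule mult_mat_vec_carrier[OF P xy(2)])
  have Au: "A *\<^sub>v u = c \<cdot>\<^sub>v u" unfolding u_def AP[OF xy(1)] xy(4) by (rule mult_mat_vec[OF P xy(1)])
  have Aw: "A *\<^sub>v w = c \<cdot>\<^sub>v w + u"
    unfolding w_def u_def AP[OF xy(2)] xy(5)
    using mult_add_distrib_mat_vec[OF P _ xy(1), of "c \<cdot>\<^sub>v y"] xy(2) mult_mat_vec[OF P xy(2)] by simp
  have "c * (w \<bullet>c u) + u \<bullet>c u = (A *\<^sub>v w) \<bullet>c u"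
    unfolding Aw using cinner_add_left[OF _ u u, of "c \<cdot>\<^sub>v w"] w cinner_smult_left[OF w u] by simp
  also have "\<dots> = w \<bullet>c (mat_adjoint A *\<^sub>v u)" by (rule cinner_adjoint[OF A w u])
  also have "\<dots> = c * (w \<bullet>c u)"
    unfolding op_norm_le_adjoint_eigenvector[OF A b u Au] using cinner_smult_right[OF w u] by simp
  finally have "euclid_norm u = 0" by (simp add: cinner_self)
  then have "u = 0\<^sub>v n" using euclid_norm_eq_0_iff[OF u] by simp
  then have "x = 0\<^sub>v n" using QP[OF xy(1)] mult_mat_zero_vec[OF Q] by (simp add: u_def)
  then show False using xy(3) by simp
qed

lemma eigenvalue_le_op_norm:
  assumes A: "A \<in> carrier_mat n n" and b: "op_norm_le A C" and e: "eigenvalue A l"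
  shows "cmod l \<le> C"
proof -
  obtain x where x: "x \<in> carrier_vec n" "x \<noteq> 0\<^sub>v n" "A *\<^sub>v x = l \<cdot>\<^sub>v x"
    using e A by (auto simp: eigenvalue_def eigenvector_def)
  have "cmod l * euclid_norm x \<le> C * euclid_norm x"
    using op_norm_leD[OF b A x(1)] by (simp add: x(3) euclid_norm_smult)
  then show ?thesis using euclid_norm_pos[OF x(1,2)] by simp
qed

lemma numerical_radius_attained_eigenvalue:
  assumes A: "A \<in> carrier_mat n n" and n: "n \<ge> 1" and b: "op_norm_le A (numerical_radius A)"
  shows "\<exists>l. eigenvalue A l \<and> cmod l = numerical_radius A"
proof -
  obtain x where x: "x \<in> carrier_vec n" "euclid_norm x = 1"
    and e: "cmod ((A *\<^sub>v x) \<bullet>c x) = numerical_radius A"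
    using numerical_radius_max_vector[OF A n] by blast
  have "A *\<^sub>v x = ((A *\<^sub>v x) \<bullet>c x) \<cdot>\<^sub>v x"
    by (rule op_norm_le_attained_eigenvector[OF A b x e])
  moreover have "x \<noteq> 0\<^sub>v n" using x euclid_norm_eq_0_iff[OF x(1)] by auto
  ultimately show ?thesis using A x e by (auto simp: eigenvalue_def eigenvector_def)
qed

lemma eigenvalue_iff_linear_factor:
  fixes A :: "complex mat"
  assumes "A \<in> carrier_mat n n" "char_poly A = (\<Prod>i\<in>I. [:- a i, 1:])" "finite I"
  shows "eigenvalue A l \<longleftrightarrow> l \<in> a ` I"
  using assms by (auto simp: eigenvalue_root_char_poly poly_prod)

lemma diag_block_mat_pair:
  assumes "X \<in> carrier_mat p p" "Y \<in> carrier_mat q q"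
  shows "diag_block_mat [X, Y] = four_block_mat X (0\<^sub>m p q) (0\<^sub>m q p) Y"
  unfolding diag_block_mat.simps(2)[of X "[Y]"] diag_block_mat_singleton Let_def
  using assms by simp

text \<open>The characteristic polynomial of the block diagonal matrix is the product of those of the blocks;
  cancelling the factors of the diagonal block leaves the factors with index at least \<open>k\<close>.\<close>

lemma block_diagonal_eigenvalue:
  fixes D' :: "complex mat"
  assumes D': "D' \<in> carrier_mat (n - k) (n - k)" and k: "k \<le> n"
    and cp: "char_poly (diag_block_mat [mat_diag k a, D']) = (\<Prod>i<n. [:- a i, 1:])"
    and e: "eigenvalue D' l"
  shows "\<exists>i. k \<le> i \<and> i < n \<and> l = a i"
proof -
  have K: "mat_diag k a \<in> carrier_mat k k" by simp
  have "upper_triangular (mat_diag k a)" by (auto simp: mat_diag_def)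
  then have cK: "char_poly (mat_diag k a) = (\<Prod>a \<leftarrow> diag_mat (mat_diag k a). [:- a, 1:])"
    by (rule char_poly_upper_triangular[OF K])
  have dm: "diag_mat (mat_diag k a) = map a [0..<k]"
    by (auto simp: diag_mat_def mat_diag_def)
  have cK': "char_poly (mat_diag k a) = (\<Prod>i<k. [:- a i, 1:])"
    unfolding cK dm by (simp add: prod.list_conv_set_nth lessThan_atLeast0)
  have "char_poly (diag_block_mat [mat_diag k a, D']) = char_poly (mat_diag k a) * char_poly D'"
    by (rule char_poly_0_block[OF diag_block_mat_pair[OF K D'] _ _ K _ D'])
      (use cK char_poly_factorized[OF D'] in auto)
  moreover have "(\<Prod>i<n. [:- a i, 1:]) = (\<Prod>i<k. [:- a i, 1:]) * (\<Prod>i\<in>{k..<n}. [:- a i, 1:])"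
    using prod.atLeastLessThan_concat[of 0 k n "\<lambda>i. [:- a i, 1:]"] k by (simp add: lessThan_atLeast0)
  moreover have "(\<Prod>i<k. [:- a i, 1:]) \<noteq> 0" by simp
  ultimately have "char_poly D' = (\<Prod>i\<in>{k..<n}. [:- a i, 1:])"
    using cp cK' by (metis mult_cancel_left)
  then have "l \<in> a ` {k..<n}" using eigenvalue_iff_linear_factor[OF D' _ finite_atLeastLessThan] e by blast
  then show ?thesis by auto
qed

text \<open>The \<open>j\<close>-th column of \<open>U\<close> is \<open>U e\<^sub>j\<close>, and \<open>A\<^sup>p U e\<^sub>j = U D\<^sup>p e\<^sub>j\<close> for the block diagonal matrix \<open>D\<close>. So
  the first \<open>k\<close> columns are eigenvectors, and the iterates of the others are governed by the powers of
  the second block.\<close>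

lemma block_diagonalization_columns:
  assumes A: "A \<in> carrier_mat n n" and U: "unitary_mat n U" and k: "k \<le> n"
    and D': "D' \<in> carrier_mat (n - k) (n - k)"
    and D: "mat_adjoint U * A * U = diag_block_mat [mat_diag k a, D']"
  shows block_diagonalization_eigenvectors: "\<And>j. j < k \<Longrightarrow> A *\<^sub>v col U j = a j \<cdot>\<^sub>v col U j"
    and block_diagonalization_similar: "similar_mat A (diag_block_mat [mat_diag k a, D'])"
    and block_diagonalization_decay:
      "\<And>j C. \<lbrakk>k \<le> j; j < n; C > 0; \<And>\<mu>. eigenvalue D' \<mu> \<Longrightarrow> cmod \<mu> < C\<rbrakk>
        \<Longrightarrow> (\<lambda>p. euclid_norm (((\<lambda>x. A *\<^sub>v x) ^^ p) (col U j)) / C ^ p) \<longlonglongrightarrow> 0"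
proof -
  let ?D = "diag_block_mat [mat_diag k a, D']" and ?U' = "mat_adjoint U"
  have Uc: "U \<in> carrier_mat n n" and UU: "?U' * U = 1\<^sub>m n" "U * ?U' = 1\<^sub>m n"
    using U by (auto simp: unitary_mat_def)
  have U'c: "?U' \<in> carrier_mat n n" by (rule adjoint_carrier[OF Uc])
  have Dc: "?D \<in> carrier_mat n n"
    unfolding D[symmetric] by (rule mult_carrier_mat[OF mult_carrier_mat[OF U'c A] Uc])
  have "U * ?D = (U * ?U') * (A * U)"
    unfolding D[symmetric] assoc_mult_mat[OF U'c A Uc]
    by (rule assoc_mult_mat[OF Uc U'c mult_carrier_mat[OF A Uc], symmetric])
  then have UD: "U * ?D = A * U" using UU(2) A Uc by simp
  have "U * ?D * ?U' = A"
    unfolding UD assoc_mult_mat[OF A Uc U'c] UU(2) using A by simp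
  then have wit: "similar_mat_wit A ?D U ?U'"
    by (intro similar_mat_witI[of _ _ n] UU A Dc Uc U'c) simp
  then show "similar_mat A ?D" by (auto simp: similar_mat_def)
  have iter: "((\<lambda>x. A *\<^sub>v x) ^^ p) x = A ^\<^sub>m p *\<^sub>v x" if "x \<in> carrier_vec n" for p x
    using that
  proof (induction p arbitrary: x)
    case (Suc p)
    have Ax: "A *\<^sub>v x \<in> carrier_vec n" by (rule mult_mat_vec_carrier[OF A Suc.prems])
    show ?case
      using Suc.IH[OF Ax] assoc_mult_mat_vec[OF pow_carrier_mat[OF A] A Suc.prems, of p]
      by (simp add: funpow_swap1)
  qed (use A in simp)
  have columns: "((\<lambda>x. A *\<^sub>v x) ^^ p) (col U j) = U *\<^sub>v col (?D ^\<^sub>m p) j" if j: "j < n" for p j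
  proof -
    have e: "col U j = U *\<^sub>v unit_vec n j" by (rule mult_mat_unit_vec[OF Uc j, symmetric])
    have cj: "col U j \<in> carrier_vec n" using Uc j by auto
    have Dp: "?D ^\<^sub>m p \<in> carrier_mat n n" by (rule pow_carrier_mat[OF Dc])
    have "?U' *\<^sub>v col U j = unit_vec n j"
      unfolding e using assoc_mult_mat_vec[OF U'c Uc unit_vec_carrier[of n j]] UU(1) by simp
    then have "A ^\<^sub>m p *\<^sub>v col U j = (U * ?D ^\<^sub>m p) *\<^sub>v unit_vec n j"
      unfolding similar_mat_wit_pow_id[OF wit]
      using assoc_mult_mat_vec[OF mult_carrier_mat[OF Uc Dp] U'c cj] by simp
    also have "\<dots> = U *\<^sub>v col (?D ^\<^sub>m p) j"
      using assoc_mult_mat_vec[OF Uc Dp unit_vec_carrier[of n j]] mult_mat_unit_vec[OF Dp j] by simp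
    finally show ?thesis using iter[OF cj] by simp
  qed
  show "A *\<^sub>v col U j = a j \<cdot>\<^sub>v col U j" if j: "j < k" for j
  proof -
    have jn: "j < n" using j k by simp
    have "col ?D j = a j \<cdot>\<^sub>v unit_vec n j"
      by (rule eq_vecI) (use j k D' Dc jn in \<open>auto simp: Let_def mat_diag_def\<close>)
    then have "U *\<^sub>v col ?D j = a j \<cdot>\<^sub>v col U j"
      using mult_mat_vec[OF Uc unit_vec_carrier[of n j]] mult_mat_unit_vec[OF Uc jn] by simp
    then show ?thesis using columns[OF jn, of 1] Dc by simp
  qed
  show "(\<lambda>p. euclid_norm (((\<lambda>x. A *\<^sub>v x) ^^ p) (col U j)) / C ^ p) \<longlonglongrightarrow> 0"
    if j: "k \<le> j" "j < n" and C: "C > 0" and ev: "\<And>\<mu>. eigenvalue D' \<mu> \<Longrightarrow> cmod \<mu> < C" for j C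
  proof -
    have entry: "cmod ((?D ^\<^sub>m p) $$ (i, j)) = (if i < k then 0 else cmod ((D' ^\<^sub>m p) $$ (i - k, j - k)))"
      if i: "i < n" for i p
    proof -
      have "?D ^\<^sub>m p = diag_block_mat [mat_diag k a ^\<^sub>m p, D' ^\<^sub>m p]"
        using D' by (subst diag_block_pow_mat) (auto simp: mat_diag_def)
      moreover have "mat_diag k a ^\<^sub>m p \<in> carrier_mat k k" "D' ^\<^sub>m p \<in> carrier_mat (n - k) (n - k)"
        using D' by (auto intro: pow_carrier_mat)
      ultimately have "?D ^\<^sub>m p = four_block_mat (mat_diag k a ^\<^sub>m p) (0\<^sub>m k (n - k))
          (0\<^sub>m (n - k) k) (D' ^\<^sub>m p)"
        and dims: "dim_row (mat_diag k a ^\<^sub>m p) = k" "dim_col (mat_diag k a ^\<^sub>m p) = k"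
          "dim_row (D' ^\<^sub>m p) = n - k" "dim_col (D' ^\<^sub>m p) = n - k"
        by (auto simp only: diag_block_mat_pair carrier_matD)
      then show ?thesis using i j k by (simp only: index_mat_four_block dims) auto
    qed
    have entry_decay: "(\<lambda>p. cmod ((?D ^\<^sub>m p) $$ (i, j)) / C ^ p) \<longlonglongrightarrow> 0" if i: "i < n" for i
      unfolding entry[OF i]
    proof (cases "i < k")
      case False
      then show "(\<lambda>p. (if i < k then 0 else cmod ((D' ^\<^sub>m p) $$ (i - k, j - k))) / C ^ p) \<longlonglongrightarrow> 0"
        using spectral_radius_less_power_decay[OF D' C ev, of "i - k" "j - k"] i j by simp
    qed simp
    obtain M where M: "op_norm_le U M" using op_norm_le_exists[OF Uc] by blast
    have M': "op_norm_le U \<bar>M\<bar>"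
      using M unfolding op_norm_le_def
      by (meson abs_ge_self euclid_norm_nonneg mult_right_mono order_trans)
    have bound: "euclid_norm (((\<lambda>x. A *\<^sub>v x) ^^ p) (col U j)) / C ^ p
        \<le> \<bar>M\<bar> * (\<Sum>i<n. cmod ((?D ^\<^sub>m p) $$ (i, j)) / C ^ p)" for p
    proof -
      let ?c = "col (?D ^\<^sub>m p) j"
      have Dp: "?D ^\<^sub>m p \<in> carrier_mat n n" by (rule pow_carrier_mat[OF Dc])
      have c: "?c \<in> carrier_vec n" using Dp j by auto
      have "euclid_norm ?c \<le> (\<Sum>i<n. cmod (?c $ i))"
        using carrier_vecD[OF c] L2_set_le_sum[of "{..<n}" "\<lambda>i. cmod (?c $ i)"]
        by (simp only: euclid_norm_L2) simp
      also have "\<dots> = (\<Sum>i<n. cmod ((?D ^\<^sub>m p) $$ (i, j)))"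
        by (rule sum.cong) (use carrier_matD[OF Dp] j in auto)
      finally have "euclid_norm (U *\<^sub>v ?c) \<le> \<bar>M\<bar> * (\<Sum>i<n. cmod ((?D ^\<^sub>m p) $$ (i, j)))"
        using op_norm_leD[OF M' Uc c] by (meson abs_ge_zero mult_left_mono order_trans)
      then show ?thesis
        unfolding columns[OF j(2)] sum_divide_distrib[symmetric] times_divide_eq_right
        using C by (intro divide_right_mono) auto
    qed
    have "(\<lambda>p. \<bar>M\<bar> * (\<Sum>i<n. cmod ((?D ^\<^sub>m p) $$ (i, j)) / C ^ p)) \<longlonglongrightarrow> 0"
      by (intro tendsto_mult_right_zero tendsto_null_sum entry_decay) auto
    then show ?thesis
      by (rule tendsto_sandwich[OF _ _ tendsto_const, rotated 2])
        (use bound C in \<open>auto intro!: always_eventually\<close>)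
  qed
qed

section \<open>Extremal Schur powers\<close>

text \<open>A tensor of columns of \<open>U\<close> outside the generating set has a factor with index at least \<open>k\<close>, which
  decays, so \<open>v\<close> is orthogonal to it. Positivity of \<open>C\<close> is required only if such a factor exists, which
  admits the zero matrix with \<open>k = n\<close>.\<close>

lemma extremal_eigenvector_in_column_tensor_span:
  assumes A: "A \<in> carrier_mat n n" and b: "op_norm_le A C" and k: "k \<le> n"
    and C: "k < n \<Longrightarrow> C > 0"
    and U: "unitary_mat n U" and D': "D' \<in> carrier_mat (n - k) (n - k)"
    and D: "mat_adjoint U * A * U = diag_block_mat [mat_diag k a, D']"
    and ev: "\<And>\<mu>. eigenvalue D' \<mu> \<Longrightarrow> cmod \<mu> < C"
    and v: "v \<in> carrier_vec (n ^ m)" "kron_power A m *\<^sub>v v = c \<cdot>\<^sub>v v" and c: "cmod c = C ^ m"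
  shows "v \<in> column_tensor_span n m k U"
proof (rule column_tensor_span_complete[OF U k v(1)])
  have Uc: "U \<in> carrier_mat n n" and UU: "mat_adjoint U * U = 1\<^sub>m n"
    using U by (auto simp: unitary_mat_def)
  have norm1: "euclid_norm (col U j) = 1" if "j < n" for j
  proof -
    have c: "col U j \<in> carrier_vec n" using Uc that by auto
    have "(mat_adjoint U * 1\<^sub>m n * U) $$ (j, j) = col U j \<bullet>c col U j"
      using cinner_mult_mat_columns[OF one_carrier_mat Uc that that] c by simp
    also have "mat_adjoint U * 1\<^sub>m n * U = 1\<^sub>m n"
      using right_mult_one_mat[OF adjoint_carrier[OF Uc]] UU by simp
    finally have "complex_of_real ((euclid_norm (col U j))\<^sup>2) = complex_of_real 1"
      using that by (simp add: cinner_self)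
    then have "(euclid_norm (col U j))\<^sup>2 = 1\<^sup>2" by (simp only: of_real_eq_iff) simp
    then show ?thesis by (rule power2_eq_imp_eq) simp_all
  qed
  fix js assume js: "length js = m" "set js \<subseteq> {..<n}" "\<not> set js \<subseteq> {..<k}"
  then obtain j where j: "j \<in> set js" "k \<le> j" "j < n" by force
  have pos: "C > 0" using C j by simp
  show "v \<bullet>c kron_vecs (map (col U) js) = 0"
  proof (rule decaying_factor_orthogonal[OF A b pos _ _ _ _ _ v c])
    show "set (map (col U) js) \<subseteq> carrier_vec n" using Uc by auto
    show "length (map (col U) js) = m" using js by simp
    show "col U j \<in> set (map (col U) js)" using j by simp
    show "euclid_norm u \<le> 1" if "u \<in> set (map (col U) js)" for u
      using that norm1 js(2) by (auto simp: subset_iff)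
    show "(\<lambda>p. euclid_norm (((\<lambda>x. A *\<^sub>v x) ^^ p) (col U j)) / C ^ p) \<longlonglongrightarrow> 0"
      by (rule block_diagonalization_decay[OF A U k D' D j(2,3) pos ev])
  qed
qed

text \<open>For \<open>C = 0\<close> the matrix vanishes and with it all Schur powers of positive exponent; otherwise the
  exponent is lowered one step at a time.\<close>

lemma numerical_radius_schur_power_descent:
  assumes A: "A \<in> carrier_mat n n" and n: "n \<ge> 1" and b: "op_norm_le A C" and C: "C \<ge> 0"
    and eq: "numerical_radius (schur_power A m) = C ^ m" and m': "1 \<le> m'" "m' \<le> m"
  shows "numerical_radius (schur_power A m') = C ^ m'"
proof (cases "C = 0")
  case True
  have S: "schur_power A m' \<in> carrier_mat n n" using A by simp
  have "A $$ (i, j) = 0" if ij: "i < n" "j < n" for i j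
  proof -
    have Ac: "col A j \<in> carrier_vec n" using A ij by auto
    have "euclid_norm (col A j) \<le> 0"
      using op_norm_leD[OF b A unit_vec_carrier[of n j]] mult_mat_unit_vec[OF A ij(2)] True by simp
    then have "euclid_norm (col A j) = 0" using euclid_norm_nonneg[of "col A j"] by linarith
    then have "col A j = 0\<^sub>v n" using euclid_norm_eq_0_iff[OF Ac] by simp
    then have "col A j $ i = 0" using ij by simp
    then show ?thesis using A ij by simp
  qed
  then have "schur_power A m' = 0\<^sub>m n n"
    by (intro eq_matI) (use A m' in \<open>auto simp: schur_power_def\<close>)
  moreover have "0\<^sub>m n n *\<^sub>v x = 0\<^sub>v n" if "x \<in> carrier_vec n" for x :: "complex vec"
    by (rule eq_vecI) (use that in auto)
  ultimately have "(schur_power A m' *\<^sub>v x) \<bullet>c x = 0" if "x \<in> carrier_vec n" for x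
    using that by simp
  then show ?thesis using numerical_radius_max_vector[OF S n] True m' by auto
next
  case False
  then have pos: "C > 0" using C by simp
  let ?P = "\<lambda>m. \<exists>v \<in> diagonal_tensor_span n m. \<exists>c. eigenvector (kron_power A m) v c \<and> cmod c = C ^ m"
  have iff: "numerical_radius (schur_power A q) = C ^ q \<longleftrightarrow> ?P q" if "q \<ge> 1" for q
    by (rule numerical_radius_schur_power_eq_iff[OF A n that b C])
  have "?P m'"
    using m'(2)
  proof (induction rule: inc_induct)
    case base
    show ?case using eq iff[of m] m' by simp
  next
    case (step q)
    then show ?case using diagonal_eigenvector_descent[OF A b pos, of q] m' by simp
  qed
  then show ?thesis using iff m' by simp
qed

theorem theorem4p8:
  fixes m n k :: nat and A :: "complex mat" and a :: "nat \<Rightarrow> complex"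
  assumes "m \<ge> 1" and "n \<ge> 1"
    and "A \<in> carrier_mat n n"
    and "numerical_radius A = spectral_norm A"
    and "char_poly A = (\<Prod>i<n. [:- a i, 1:])"
    and "1 \<le> k" and "k \<le> n"
    and "\<forall>i<k. cmod (a i) = cmod (a 0)"
    and "\<forall>i. k \<le> i \<and> i < n \<longrightarrow> cmod (a i) < cmod (a 0)"
  shows
    "(\<forall>blocks. jordan_nf A blocks \<longrightarrow>
        (\<forall>(s, c) \<in> set blocks. c \<in> a ` {..<k} \<longrightarrow> s = 1)) \<and>
     (\<forall>U A'. unitary_mat n U \<and> A' \<in> carrier_mat (n - k) (n - k) \<and>
          mat_adjoint U * A * U = diag_block_mat [mat_diag k a, A'] \<longrightarrow>
        (numerical_radius (schur_power A m) = numerical_radius A ^ m \<longleftrightarrow>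
          (column_tensor_span n m k U \<inter> diagonal_tensor_span n m \<noteq> {0\<^sub>v (n ^ m)} \<and>
           (\<exists>v \<in> column_tensor_span n m k U \<inter> diagonal_tensor_span n m.
              \<exists>c. eigenvector (kron_power A m) v c)))) \<and>
     (numerical_radius (schur_power A m) = numerical_radius A ^ m \<longleftrightarrow>
        (\<exists>v \<in> diagonal_tensor_span n m.
           \<exists>c. eigenvector (kron_power A m) v c \<and> cmod c = cmod (a 0) ^ m)) \<and>
     cmod (a 0) ^ m = spectral_norm A ^ m \<and>
     (numerical_radius (schur_power A m) = numerical_radius A ^ m \<longrightarrow>
        (\<forall>m'. 1 \<le> m' \<and> m' \<le> m \<longrightarrow>
           numerical_radius (schur_power A m') = numerical_radius A ^ m'))"
proof -
  note m = assms(1) and n = assms(2) and A = assms(3) and w = assms(4) and cp = assms(5)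
    and k = assms(6,7) and eq = assms(8)[rule_format] and less = assms(9)[rule_format, OF conjI]
  have b: "op_norm_le A (numerical_radius A)" unfolding w by (rule op_norm_le_spectral_norm[OF A])
  have ev: "eigenvalue A l \<longleftrightarrow> l \<in> a ` {..<n}" for l
    by (rule eigenvalue_iff_linear_factor[OF A cp finite_lessThan])
  have le: "cmod (a i) \<le> cmod (a 0)" if "i < n" for i
    using eq[of i] less[of i] that by (cases "i < k") auto
  have a0: "cmod (a 0) = numerical_radius A"
  proof (rule antisym)
    show "cmod (a 0) \<le> numerical_radius A"
      by (rule eigenvalue_le_op_norm[OF A b]) (use ev n in auto)
    show "numerical_radius A \<le> cmod (a 0)"
      using numerical_radius_attained_eigenvalue[OF A n b] ev le by (metis imageE lessThan_iff)
  qed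
  define C where "C = numerical_radius A"
  have C: "C \<ge> 0" and b: "op_norm_le A C" and a0: "cmod (a 0) = C" and SC: "spectral_norm A = C"
    using b a0 w norm_ge_zero[of "a 0"] by (simp_all add: C_def)
  have aC: "cmod (a i) = C" if "i < k" for i using eq[OF that] a0 by simp
  note iff = numerical_radius_schur_power_eq_iff[OF A n m b C]
  have jordan: "s = 1"
    if jnf: "jordan_nf A blocks" "(s, c) \<in> set blocks" "c \<in> a ` {..<k}" for blocks s c
    by (rule extremal_jordan_blocks_trivial[OF A _ jnf(1,2)]) (use b aC jnf(3) in auto)
  have columns: "numerical_radius (schur_power A m) = C ^ m \<longleftrightarrow>
      (column_tensor_span n m k U \<inter> diagonal_tensor_span n m \<noteq> {0\<^sub>v (n ^ m)} \<and>
       (\<exists>v \<in> column_tensor_span n m k U \<inter> diagonal_tensor_span n m.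
          \<exists>c. eigenvector (kron_power A m) v c))" (is "_ \<longleftrightarrow> ?R")
    if U: "unitary_mat n U" and D': "D' \<in> carrier_mat (n - k) (n - k)"
      and D: "mat_adjoint U * A * U = diag_block_mat [mat_diag k a, D']" for U D'
  proof
    have K: "kron_power A m \<in> carrier_mat (n ^ m) (n ^ m)" using A by simp
    have cpD: "char_poly (diag_block_mat [mat_diag k a, D']) = (\<Prod>i<n. [:- a i, 1:])"
      using char_poly_similar[OF block_diagonalization_similar[OF A U k(2) D' D]] cp by simp
    have evD: "cmod \<mu> < C" if "eigenvalue D' \<mu>" for \<mu>
      using block_diagonal_eigenvalue[OF D' k(2) cpD that] less a0 by auto
    have pos: "C > 0" if "k < n" using less[OF le_refl that] a0 norm_ge_zero[of "a k"] by linarith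
    {
      assume "numerical_radius (schur_power A m) = C ^ m"
      then obtain v c where v: "v \<in> diagonal_tensor_span n m"
        and e: "eigenvector (kron_power A m) v c" and c: "cmod c = C ^ m"
        using iff by auto
      have "v \<in> column_tensor_span n m k U"
        by (rule extremal_eigenvector_in_column_tensor_span[OF A b k(2) pos U D' D evD _ _ c])
          (use e carrier_matD[OF K] in \<open>auto simp: eigenvector_def\<close>)
      moreover have "v \<noteq> 0\<^sub>v (n ^ m)" using e carrier_matD[OF K] by (simp add: eigenvector_def)
      ultimately show ?R using v e by blast
    }
    {
      assume ?R
      then obtain v c where v: "v \<in> column_tensor_span n m k U" "v \<in> diagonal_tensor_span n m"
        and e: "eigenvector (kron_power A m) v c"
        by auto
      have "U \<in> carrier_mat n n" using U by (simp add: unitary_mat_def)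
      from column_tensor_span_eigenvalue[OF A b C this k(2)
          block_diagonalization_eigenvectors[OF A U k(2) D' D] aC v(1) e]
      have "cmod c = C ^ m" .
      then show "numerical_radius (schur_power A m) = C ^ m" using iff v(2) e by auto
    }
  qed
  have descent: "numerical_radius (schur_power A m') = C ^ m'"
    if "numerical_radius (schur_power A m) = C ^ m" "1 \<le> m' \<and> m' \<le> m" for m'
    using numerical_radius_schur_power_descent[OF A n b C that(1)] that(2) by blast
  show ?thesis
    unfolding a0 SC C_def[symmetric]
  proof (intro conjI)
    show "\<forall>blocks. jordan_nf A blocks \<longrightarrow>
        (\<forall>(s, c) \<in> set blocks. c \<in> a ` {..<k} \<longrightarrow> s = 1)"
      using jordan by blast
    show "\<forall>U A'. unitary_mat n U \<and> A' \<in> carrier_mat (n - k) (n - k) \<and>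
          mat_adjoint U * A * U = diag_block_mat [mat_diag k a, A'] \<longrightarrow>
        (numerical_radius (schur_power A m) = C ^ m \<longleftrightarrow>
          (column_tensor_span n m k U \<inter> diagonal_tensor_span n m \<noteq> {0\<^sub>v (n ^ m)} \<and>
           (\<exists>v \<in> column_tensor_span n m k U \<inter> diagonal_tensor_span n m.
              \<exists>c. eigenvector (kron_power A m) v c)))"
      by (intro allI impI, elim conjE, rule columns)
    show "numerical_radius (schur_power A m) = C ^ m \<longrightarrow>
        (\<forall>m'. 1 \<le> m' \<and> m' \<le> m \<longrightarrow> numerical_radius (schur_power A m') = C ^ m')"
      using descent by blast
  qed (rule iff, rule refl)
qed

end
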